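(* Let $(R,\mathfrak{m})$ be a one-dimensional Cohen-Macaulay local ring with total ring of fractions $Q$, and let $I$ be an $\mathfrak{m}$-primary ideal of $R$. If $x\in\mathfrak{m}(xR:_Q I)$ for some nonzerodivisor $x\in\mathfrak{m}$, then $I$ is Elias.
   Context: Local rings are commutative and Noetherian. $(xR:_Q I)=\{q\in Q\mid qI\subseteq xR\}$, an $R$-submodule of $Q$. For a finitely generated $R$-module $M$ over a local ring $(R,\mathfrak{m},k)$, $\operatorname{type}_R(M):=\dim_k\operatorname{Ext}_R^{\dim_R M}(k,M)$. An $\mathfrak{m}$-primary ideal $I$ of a one-dimensional Cohen-Macaulay local ring $R$ is Elias if $\operatorname{type}_R(I)=\operatorname{type}_R(R/I)$. *)

theory Defs
  imports
    "HOL-Algebra.Algebra"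
    "HOL-Library.Extended_Nat"
    "Jordan_Normal_Form.Missing_VectorSpace"
begin

section \<open>Rings\<close>

definition nonzerodivisor :: "('a, 'r) ring_scheme \<Rightarrow> 'a \<Rightarrow> bool" where
  "nonzerodivisor R x \<longleftrightarrow>
     x \<in> carrier R \<and> (\<forall>y \<in> carrier R. x \<otimes>\<^bsub>R\<^esub> y = \<zero>\<^bsub>R\<^esub> \<longrightarrow> y = \<zero>\<^bsub>R\<^esub>)"

definition radical :: "('a, 'r) ring_scheme \<Rightarrow> 'a set \<Rightarrow> 'a set" where
  "radical R I = {a \<in> carrier R. \<exists>n::nat. a [^]\<^bsub>R\<^esub> n \<in> I}"

definition primary_ideal :: "'a set \<Rightarrow> ('a, 'r) ring_scheme \<Rightarrow> bool" where
  "primary_ideal I R \<longleftrightarrow> ideal I R \<and> I \<noteq> carrier R \<and>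
     (\<forall>a \<in> carrier R. \<forall>b \<in> carrier R. a \<otimes>\<^bsub>R\<^esub> b \<in> I \<longrightarrow> a \<in> I \<or> (\<exists>n::nat. b [^]\<^bsub>R\<^esub> n \<in> I))"

definition primary_to :: "('a, 'r) ring_scheme \<Rightarrow> 'a set \<Rightarrow> 'a set \<Rightarrow> bool" where
  "primary_to R p I \<longleftrightarrow> primary_ideal I R \<and> radical R I = p"

text \<open>The supremum over the empty set is \<open>0\<close>, so the zero ring gets dimension \<open>0\<close> here.\<close>

definition krull_dim :: "('a, 'r) ring_scheme \<Rightarrow> enat" where
  "krull_dim R = Sup {enat n | n. \<exists>p :: nat \<Rightarrow> 'a set.
     (\<forall>i \<le> n. primeideal (p i) R) \<and> (\<forall>i < n. p i \<subset> p (Suc i))}"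

definition regular_sequence :: "('a, 'r) ring_scheme \<Rightarrow> 'a list \<Rightarrow> bool" where
  "regular_sequence R xs \<longleftrightarrow>
     set xs \<subseteq> carrier R \<and> Idl\<^bsub>R\<^esub> (set xs) \<noteq> carrier R \<and>
     (\<forall>i < length xs. let J = Idl\<^bsub>R\<^esub> (set (take i xs)) in
        nonzerodivisor (R Quot J) (J +>\<^bsub>R\<^esub> (xs ! i)))"

definition depth :: "('a, 'r) ring_scheme \<Rightarrow> 'a set \<Rightarrow> enat" where
  "depth R m = Sup {enat (length xs) | xs. set xs \<subseteq> m \<and> regular_sequence R xs}"

locale noetherian_local_ring = cring R + noetherian_ring R
  for R (structure) +
  fixes m :: "'a set"
  assumes maximal: "maximalideal m R"
    and maximal_unique: "maximalideal n R \<Longrightarrow> n = m"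

locale cohen_macaulay_local_ring = noetherian_local_ring +
  assumes depth_eq_dim: "depth R m = krull_dim R"

text \<open>
  \<open>Q\<close> together with \<open>\<iota> : R \<rightarrow> Q\<close> is the localization of \<open>R\<close> at the set of all its nonzerodivisors.
  This determines \<open>(Q, \<iota>)\<close> up to unique isomorphism. The map \<open>\<iota>\<close> is injective because its kernel
  consists of the elements killed by some nonzerodivisor.
\<close>

locale total_ring_of_fractions = R: cring R + Q: cring Q
  for R :: "('a, 'r) ring_scheme" and Q :: "('q, 's) ring_scheme" and \<iota> :: "'a \<Rightarrow> 'q" +
  assumes hom: "\<iota> \<in> ring_hom R Q"
    and inj: "inj_on \<iota> (carrier R)"
    and units: "nonzerodivisor R s \<Longrightarrow> \<iota> s \<in> Units Q"
    and fractions: "q \<in> carrier Q \<Longrightarrow>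
      \<exists>a \<in> carrier R. \<exists>s. nonzerodivisor R s \<and> q = \<iota> a \<otimes>\<^bsub>Q\<^esub> inv\<^bsub>Q\<^esub> (\<iota> s)"

text \<open>\<open>xR :\<^sub>Q I\<close>, where \<open>R\<close> is identified with its image in \<open>Q\<close>.\<close>

definition frac_colon ::
  "('a, 'r) ring_scheme \<Rightarrow> ('q, 's) ring_scheme \<Rightarrow> ('a \<Rightarrow> 'q) \<Rightarrow> 'a \<Rightarrow> 'a set \<Rightarrow> 'q set" where
  "frac_colon R Q \<iota> x I = {q \<in> carrier Q. \<forall>a \<in> I. q \<otimes>\<^bsub>Q\<^esub> \<iota> a \<in> \<iota> ` (PIdl\<^bsub>R\<^esub> x)}"


section \<open>Modules\<close>

text \<open>
  The record type of modules extends that of rings. The fields \<open>mult\<close> and \<open>one\<close> of a module are not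
  used by the module axioms; where no multiplication is at hand they are filled with zeros.
\<close>

definition regular_module :: "('a, 'r) ring_scheme \<Rightarrow> ('a, 'a) module" where
  "regular_module R = \<lparr>carrier = carrier R, monoid.mult = monoid.mult R, one = \<one>\<^bsub>R\<^esub>,
     ring.zero = \<zero>\<^bsub>R\<^esub>, add = add R, smult = monoid.mult R\<rparr>"

definition quotient_module :: "('a, 'v, 'c) module_scheme \<Rightarrow> 'v set \<Rightarrow> ('a, 'v set) module" where
  "quotient_module M N = \<lparr>carrier = a_rcosets\<^bsub>M\<^esub> N, monoid.mult = (\<lambda>A B. N), one = N,
     ring.zero = N, add = set_add M,
     smult = (\<lambda>r A. \<Union>v \<in> A. N +>\<^bsub>M\<^esub> (r \<odot>\<^bsub>M\<^esub> v))\<rparr>"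

definition hom_module :: "('a, 'r) ring_scheme \<Rightarrow> ('a, 'u, 'c) module_scheme \<Rightarrow>
    ('a, 'v, 'd) module_scheme \<Rightarrow> ('a, 'u \<Rightarrow> 'v) module" where
  "hom_module R M N = \<lparr>carrier = module_hom R M N \<inter> extensional (carrier M),
     monoid.mult = (\<lambda>f g. \<lambda>v \<in> carrier M. \<zero>\<^bsub>N\<^esub>), one = (\<lambda>v \<in> carrier M. \<zero>\<^bsub>N\<^esub>),
     ring.zero = (\<lambda>v \<in> carrier M. \<zero>\<^bsub>N\<^esub>),
     add = (\<lambda>f g. \<lambda>v \<in> carrier M. f v \<oplus>\<^bsub>N\<^esub> g v),
     smult = (\<lambda>r f. \<lambda>v \<in> carrier M. r \<odot>\<^bsub>N\<^esub> f v)\<rparr>"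

definition annihilator :: "('a, 'r) ring_scheme \<Rightarrow> ('a, 'v, 'c) module_scheme \<Rightarrow> 'a set" where
  "annihilator R M = {r \<in> carrier R. \<forall>v \<in> carrier M. r \<odot>\<^bsub>M\<^esub> v = \<zero>\<^bsub>M\<^esub>}"

definition module_dim :: "('a, 'r) ring_scheme \<Rightarrow> ('a, 'v, 'c) module_scheme \<Rightarrow> enat" where
  "module_dim R M = krull_dim (R Quot annihilator R M)"


section \<open>Ext\<close>

abbreviation free_module :: "('a, 'r) ring_scheme \<Rightarrow> nat \<Rightarrow> ('a, nat \<Rightarrow> 'a) module" where
  "free_module R n \<equiv> ring.func_space R {..<n}"

text \<open>
  A resolution of \<open>N\<close> by free modules of finite rank:
  \<open>\<dots> \<rightarrow> R\<^bsup>rk 2\<^esup> \<rightarrow> R\<^bsup>rk 1\<^esup> \<rightarrow> R\<^bsup>rk 0\<^esup> \<rightarrow> N \<rightarrow> 0\<close> is exact, where \<open>d n : R\<^bsup>rk (n + 1)\<^esup> \<rightarrow> R\<^bsup>rk n\<^esup>\<close>.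
\<close>

definition free_resolution :: "('a, 'r) ring_scheme \<Rightarrow> ('a, 'v, 'c) module_scheme \<Rightarrow>
    (nat \<Rightarrow> nat) \<Rightarrow> (nat \<Rightarrow> (nat \<Rightarrow> 'a) \<Rightarrow> (nat \<Rightarrow> 'a)) \<Rightarrow> ((nat \<Rightarrow> 'a) \<Rightarrow> 'v) \<Rightarrow> bool" where
  "free_resolution R N rk d \<epsilon> \<longleftrightarrow> (let F = (\<lambda>n. free_module R (rk n)) in
     \<epsilon> \<in> module_hom R (F 0) N \<and>
     (\<forall>n. d n \<in> module_hom R (F (Suc n)) (F n)) \<and>
     \<epsilon> ` carrier (F 0) = carrier N \<and>
     d 0 ` carrier (F 1) = {v \<in> carrier (F 0). \<epsilon> v = \<zero>\<^bsub>N\<^esub>} \<and>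
     (\<forall>n. d (Suc n) ` carrier (F (Suc (Suc n))) = {v \<in> carrier (F (Suc n)). d n v = \<zero>\<^bsub>F n\<^esub>}))"

text \<open>
  The cohomology of the complex \<open>Hom\<^sub>R(F\<^sub>0, M) \<rightarrow> Hom\<^sub>R(F\<^sub>1, M) \<rightarrow> \<dots>\<close> with \<open>F\<^sub>n = R\<^bsup>rk n\<^esup>\<close>, whose
  differentials are precomposition with the \<open>d n\<close>.
\<close>

definition cocycles :: "('a, 'r) ring_scheme \<Rightarrow> (nat \<Rightarrow> nat) \<Rightarrow>
    (nat \<Rightarrow> (nat \<Rightarrow> 'a) \<Rightarrow> (nat \<Rightarrow> 'a)) \<Rightarrow> ('a, 'v, 'c) module_scheme \<Rightarrow> nat \<Rightarrow> ((nat \<Rightarrow> 'a) \<Rightarrow> 'v) set"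
  where
  "cocycles R rk d M n = {f \<in> carrier (hom_module R (free_module R (rk n)) M).
     compose (carrier (free_module R (rk (Suc n)))) f (d n) =
       \<zero>\<^bsub>hom_module R (free_module R (rk (Suc n))) M\<^esub>}"

fun coboundaries :: "('a, 'r) ring_scheme \<Rightarrow> (nat \<Rightarrow> nat) \<Rightarrow>
    (nat \<Rightarrow> (nat \<Rightarrow> 'a) \<Rightarrow> (nat \<Rightarrow> 'a)) \<Rightarrow> ('a, 'v, 'c) module_scheme \<Rightarrow> nat \<Rightarrow> ((nat \<Rightarrow> 'a) \<Rightarrow> 'v) set"
  where
  "coboundaries R rk d M 0 = {\<zero>\<^bsub>hom_module R (free_module R (rk 0)) M\<^esub>}"
| "coboundaries R rk d M (Suc n) =
     (\<lambda>f. compose (carrier (free_module R (rk (Suc n)))) f (d n)) `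
       carrier (hom_module R (free_module R (rk n)) M)"

definition hom_cohomology :: "('a, 'r) ring_scheme \<Rightarrow> (nat \<Rightarrow> nat) \<Rightarrow>
    (nat \<Rightarrow> (nat \<Rightarrow> 'a) \<Rightarrow> (nat \<Rightarrow> 'a)) \<Rightarrow> ('a, 'v, 'c) module_scheme \<Rightarrow> nat \<Rightarrow>
    ('a, ((nat \<Rightarrow> 'a) \<Rightarrow> 'v) set) module" where
  "hom_cohomology R rk d M n = quotient_module
     ((hom_module R (free_module R (rk n)) M)\<lparr>carrier := cocycles R rk d M n\<rparr>)
     (coboundaries R rk d M n)"

text \<open>
  \<open>Ext\<^sup>n\<^sub>R(N, M)\<close>, computed from a chosen free resolution of \<open>N\<close>. A finitely generated module over a
  noetherian ring has a resolution by free modules of finite rank, and Ext does not depend, up to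
  isomorphism, on which one is chosen. For other \<open>N\<close> the definition is not meaningful.
\<close>

definition Ext_module :: "('a, 'r) ring_scheme \<Rightarrow> ('a, 'u, 'c) module_scheme \<Rightarrow>
    ('a, 'v, 'd) module_scheme \<Rightarrow> nat \<Rightarrow> ('a, ((nat \<Rightarrow> 'a) \<Rightarrow> 'v) set) module" where
  "Ext_module R N M n =
     (case (SOME (rk, d). \<exists>\<epsilon>. free_resolution R N rk d \<epsilon>) of (rk, d) \<Rightarrow> hom_cohomology R rk d M n)"


section \<open>Type and Elias ideals\<close>

text \<open>
  An \<open>R\<close>-module \<open>V\<close> with \<open>mV = 0\<close> as a module over \<open>R/m\<close>: a residue class acts as any of its
  representatives.
\<close>

definition residue_module :: "('a, 'v, 'c) module_scheme \<Rightarrow> ('a set, 'v) module" where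
  "residue_module V = \<lparr>carrier = carrier V, monoid.mult = monoid.mult V, one = \<one>\<^bsub>V\<^esub>,
     ring.zero = \<zero>\<^bsub>V\<^esub>, add = add V,
     smult = (\<lambda>c v. THE w. \<exists>r \<in> c. w = r \<odot>\<^bsub>V\<^esub> v)\<rparr>"

text \<open>
  \<open>type\<^sub>R(M)\<close> for a nonzero finitely generated module \<open>M\<close> over a noetherian local ring \<open>(R, m)\<close>; then
  both \<open>dim\<^sub>R M\<close> and the vector space dimension are finite.
\<close>

definition module_type :: "('a, 'r) ring_scheme \<Rightarrow> 'a set \<Rightarrow> ('a, 'v, 'c) module_scheme \<Rightarrow> nat" where
  "module_type R m M = vectorspace.dim (R Quot m)
     (residue_module (Ext_module R (quotient_module (regular_module R) m) M
       (the_enat (module_dim R M))))"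

definition Elias :: "('a, 'r) ring_scheme \<Rightarrow> 'a set \<Rightarrow> 'a set \<Rightarrow> bool" where
  "Elias R m I \<longleftrightarrow>
     module_type R m ((regular_module R)\<lparr>carrier := I\<rparr>) =
     module_type R m (quotient_module (regular_module R) I)"

end

theory Submission
  imports Defs
begin

text \<open>
  Write \<open>k = R/m\<close>. The exact sequence \<open>0 \<rightarrow> I \<rightarrow> R \<rightarrow> R/I \<rightarrow> 0\<close> gives an exact sequence
  \<open>Hom(k, R) \<rightarrow> Hom(k, R/I) \<rightarrow> Ext\<^sup>1(k, I) \<rightarrow> Ext\<^sup>1(k, R)\<close>, whose first term is zero because \<open>m\<close> contains
  the nonzerodivisor \<open>x\<close>. As \<open>dim I = dim R = 1\<close> and \<open>dim R/I = 0\<close>, the two middle terms are the ones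
  whose dimensions over \<open>k\<close> are the types of \<open>R/I\<close> and of \<open>I\<close>. They are isomorphic as soon as the last
  map, induced by the inclusion \<open>j : I \<rightarrow> R\<close>, vanishes.

  The hypothesis forces this. Write \<open>x = \<Sum> a\<^sub>i q\<^sub>i\<close> with \<open>a\<^sub>i \<in> m\<close> and \<open>q\<^sub>i I \<subseteq> xR\<close>. Then
  \<open>\<psi>\<^sub>i = q\<^sub>i / x\<close> is a homomorphism \<open>I \<rightarrow> R\<close> (\<open>frac_colon_hom\<close>), and \<open>j = \<Sum> a\<^sub>i \<psi>\<^sub>i\<close>. Since
  \<open>a\<^sub>i\<close> annihilates \<open>k\<close>, it annihilates \<open>Ext\<^sup>1(k, R)\<close> (\<open>annihilated_cocycle_is_coboundary\<close>), so every
  \<open>a\<^sub>i \<psi>\<^sub>i\<close> induces zero (\<open>cocycle_into_ideal_is_coboundary\<close>).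

  Instead of building the long exact sequence, \<open>residue_cohomology_dim_eq\<close> compares the two middle
  terms directly on a resolution \<open>F\<close> of \<open>k\<close>. Let \<open>P\<close> consist of the homomorphisms
  \<open>h : F\<^sub>0 \<rightarrow> R\<close> with \<open>h (d F\<^sub>1) \<subseteq> I\<close>. Reduction modulo \<open>I\<close> maps \<open>P\<close> onto \<open>Ext\<^sup>0(k, R/I)\<close>, and
  \<open>h \<mapsto> h \<circ> d\<close> maps it onto \<open>Ext\<^sup>1(k, I)\<close> by the vanishing just explained. Both maps have the
  kernel \<open>Hom(F\<^sub>0, I)\<close>: a homomorphism \<open>F\<^sub>0 \<rightarrow> R\<close> is determined by its restriction to \<open>d F\<^sub>1 \<supseteq> x F\<^sub>0\<close>.

  A resolution by free modules of finite rank has to exist for the chosen one to be a resolution at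
  all; this is where the noetherian hypothesis enters (\<open>free_resolution_exists\<close>).
\<close>

section \<open>Modules\<close>

lemma regular_module_simps [simp]:
  "carrier (regular_module R) = carrier R"
  "\<zero>\<^bsub>regular_module R\<^esub> = \<zero>\<^bsub>R\<^esub>"
  "add (regular_module R) = add R"
  "smult (regular_module R) = monoid.mult R"
  by (simp_all add: regular_module_def)

lemma regular_module_is_module:
  assumes "cring R" shows "module R (regular_module R)"
proof -
  interpret cring R by fact
  show ?thesis
    by (rule module_criteria) (auto simp: assms a_ac m_assoc l_distr r_distr intro: r_neg)
qed

lemma ideal_is_submodule:
  assumes "cring R" "ideal I R"
  shows "LinearCombinations.submodule R I (regular_module R)"
proof -
  interpret cring R by fact
  interpret ideal I R by fact
  show ?thesis
    by (rule LinearCombinations.submodule.intro)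
      (use a_subset in \<open>auto simp: regular_module_is_module[OF assms(1)] I_l_closed\<close>)
qed

lemma submodule_minus_closed:
  assumes "LinearCombinations.submodule R N M" "v \<in> N" "w \<in> N"
  shows "v \<ominus>\<^bsub>M\<^esub> w \<in> N"
proof -
  interpret S: LinearCombinations.submodule R N M by fact
  interpret module R M by (rule S.module)
  have "w \<in> carrier M" using assms S.subset by auto
  then have "\<ominus>\<^bsub>M\<^esub> w = (\<ominus>\<^bsub>R\<^esub> \<one>\<^bsub>R\<^esub>) \<odot>\<^bsub>M\<^esub> w"
    by (simp add: smult_minus_1)
  then show ?thesis using assms by (simp add: a_minus_def)
qed

lemma submodule_finsum_closed:
  assumes "LinearCombinations.submodule R N M" "\<And>i. i \<in> A \<Longrightarrow> f i \<in> N"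
  shows "finsum M f A \<in> N"
proof -
  interpret S: LinearCombinations.submodule R N M by fact
  interpret module R M by (rule S.module)
  show ?thesis
    using assms(2)
  proof (induction A rule: infinite_finite_induct)
    case (insert a A)
    then have "f a \<in> carrier M" "f \<in> A \<rightarrow> carrier M" using S.subset by auto
    with insert show ?case by simp
  qed simp_all
qed

lemma submodule_restrict:
  assumes "LinearCombinations.submodule R N M" "LinearCombinations.submodule R N' M" "N' \<subseteq> N"
  shows "LinearCombinations.submodule R N' (M\<lparr>carrier := N\<rparr>)"
proof -
  interpret S: LinearCombinations.submodule R N M by fact
  interpret S': LinearCombinations.submodule R N' M by fact
  interpret module R M by (rule S.module)
  show ?thesis
    by (rule LinearCombinations.submodule.intro) (use assms in \<open>auto simp: submodule_is_module\<close>)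
qed

lemma mod_hom_compose:
  assumes "f \<in> module_hom R M N" "g \<in> module_hom R N P"
  shows "(\<lambda>v. g (f v)) \<in> module_hom R M P"
  using assms by (auto simp: module_hom_def Pi_iff)

lemma module_hom_restrict:
  assumes "module R M"
  shows "restrict f (carrier M) \<in> module_hom R M N \<longleftrightarrow> f \<in> module_hom R M N"
proof -
  interpret module R M by fact
  show ?thesis by (auto simp: module_hom_def Pi_iff)
qed

text \<open>Quotient modules inherit the module axioms in this way along the projection.\<close>
lemma module_surj_image:
  assumes "module R M" and surj: "q ` carrier M = carrier N"
    and q_zero: "q \<zero>\<^bsub>M\<^esub> = \<zero>\<^bsub>N\<^esub>"
    and q_add: "\<And>v w. v \<in> carrier M \<Longrightarrow> w \<in> carrier M \<Longrightarrow> q (v \<oplus>\<^bsub>M\<^esub> w) = q v \<oplus>\<^bsub>N\<^esub> q w"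
    and q_smult: "\<And>r v. r \<in> carrier R \<Longrightarrow> v \<in> carrier M \<Longrightarrow> q (r \<odot>\<^bsub>M\<^esub> v) = r \<odot>\<^bsub>N\<^esub> q v"
  shows "module R N"
proof -
  interpret module R M by fact
  note [simp] = q_zero[symmetric] q_add[symmetric] q_smult[symmetric]
  have q_closed [simp]: "q v \<in> carrier N" if "v \<in> carrier M" for v
    using surj that by blast
  have "\<exists>w\<in>carrier N. q v \<oplus>\<^bsub>N\<^esub> w = \<zero>\<^bsub>N\<^esub>" if "v \<in> carrier M" for v
    using that by (intro bexI[of _ "q (\<ominus>\<^bsub>M\<^esub> v)"]) (simp_all add: M.r_neg)
  then show ?thesis
    by (intro module_criteria R.is_cring)
      (simp_all flip: surj,
       auto simp: M.a_ac smult_assoc1 smult_l_distr smult_r_distr)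
qed


subsection \<open>Quotients\<close>

lemma quotient_module_simps [simp]:
  "carrier (quotient_module M N) = (\<lambda>v. N +>\<^bsub>M\<^esub> v) ` carrier M"
  "\<zero>\<^bsub>quotient_module M N\<^esub> = N"
  "add (quotient_module M N) = set_add M"
  by (auto simp: quotient_module_def A_RCOSETS_def' )

lemma submodule_abelian_subgroup:
  assumes "LinearCombinations.submodule R N M"
  shows "abelian_subgroup N M"
proof -
  interpret S: LinearCombinations.submodule R N M by fact
  interpret module R M by (rule S.module)
  have "\<ominus>\<^bsub>M\<^esub> v \<in> N" if "v \<in> N" for v
  proof -
    have "v \<in> carrier M" using that S.subset by blast
    then have "\<zero>\<^bsub>M\<^esub> \<ominus>\<^bsub>M\<^esub> v = \<ominus>\<^bsub>M\<^esub> v" unfolding a_minus_def by simp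
    then show ?thesis using submodule_minus_closed[OF assms S.zero_closed that] by simp
  qed
  then have "subgroup N (add_monoid M)"
    using S.subset S.zero_closed S.m_closed
    by (intro M.add.subgroupI) (auto simp flip: a_inv_def simp del: S.zero_closed)
  then show ?thesis
    by (simp add: M.abelian_group_axioms abelian_subgroupI3 additive_subgroup.intro)
qed

lemma coset_eq_iff:
  assumes "LinearCombinations.submodule R N M" "v \<in> carrier M" "w \<in> carrier M"
  shows "N +>\<^bsub>M\<^esub> v = N +>\<^bsub>M\<^esub> w \<longleftrightarrow> v \<ominus>\<^bsub>M\<^esub> w \<in> N"
proof -
  interpret abelian_subgroup N M using assms(1) by (rule submodule_abelian_subgroup)
  have "v \<in> N +>\<^bsub>M\<^esub> w \<longleftrightarrow> v \<ominus>\<^bsub>M\<^esub> w \<in> N"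
    unfolding a_minus_def by (rule a_rcos_module[OF assms(3,2)])
  then show ?thesis
    using a_repr_independence'[OF _ assms(3)] a_rcos_self[OF assms(2)] by auto
qed

lemma coset_eq_zero_iff:
  assumes "LinearCombinations.submodule R N M" "v \<in> carrier M"
  shows "N +>\<^bsub>M\<^esub> v = N \<longleftrightarrow> v \<in> N"
proof -
  interpret S: LinearCombinations.submodule R N M by fact
  interpret abelian_subgroup N M using assms(1) by (rule submodule_abelian_subgroup)
  show ?thesis using a_rcos_self[OF assms(2)] a_rcos_const by auto
qed

lemma coset_smult:
  assumes "LinearCombinations.submodule R N M" "r \<in> carrier R" "v \<in> carrier M"
  shows "r \<odot>\<^bsub>quotient_module M N\<^esub> (N +>\<^bsub>M\<^esub> v) = N +>\<^bsub>M\<^esub> (r \<odot>\<^bsub>M\<^esub> v)"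
proof -
  interpret S: LinearCombinations.submodule R N M by fact
  interpret module R M by (rule S.module)
  interpret A: abelian_subgroup N M using assms(1) by (rule submodule_abelian_subgroup)
  have "N +>\<^bsub>M\<^esub> (r \<odot>\<^bsub>M\<^esub> w) = N +>\<^bsub>M\<^esub> (r \<odot>\<^bsub>M\<^esub> v)" if w: "w \<in> N +>\<^bsub>M\<^esub> v" for w
  proof -
    have wc: "w \<in> carrier M" using A.a_elemrcos_carrier assms w by auto
    have "w \<ominus>\<^bsub>M\<^esub> v \<in> N"
      unfolding a_minus_def using A.a_rcos_module[OF assms(3) wc] w by blast
    then have "r \<odot>\<^bsub>M\<^esub> (w \<ominus>\<^bsub>M\<^esub> v) \<in> N" by (rule S.smult_closed[OF assms(2)])
    moreover have "r \<odot>\<^bsub>M\<^esub> (w \<ominus>\<^bsub>M\<^esub> v) = r \<odot>\<^bsub>M\<^esub> w \<ominus>\<^bsub>M\<^esub> r \<odot>\<^bsub>M\<^esub> v"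
      unfolding a_minus_def using assms wc
      by (simp only: smult_r_distr smult_r_minus M.a_inv_closed)
    ultimately have "r \<odot>\<^bsub>M\<^esub> w \<ominus>\<^bsub>M\<^esub> r \<odot>\<^bsub>M\<^esub> v \<in> N" by simp
    then show ?thesis
      using coset_eq_iff[OF assms(1)] smult_closed[OF assms(2)] assms(3) wc by blast
  qed
  moreover have "v \<in> N +>\<^bsub>M\<^esub> v" using A.a_rcos_self assms by auto
  ultimately have "(\<Union>w \<in> N +>\<^bsub>M\<^esub> v. N +>\<^bsub>M\<^esub> (r \<odot>\<^bsub>M\<^esub> w)) = N +>\<^bsub>M\<^esub> (r \<odot>\<^bsub>M\<^esub> v)"
    by (intro equalityI UN_least) blast+
  then show ?thesis by (simp only: quotient_module_def module.simps)
qed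

lemma coset_add:
  assumes "LinearCombinations.submodule R N M" "v \<in> carrier M" "w \<in> carrier M"
  shows "(N +>\<^bsub>M\<^esub> v) <+>\<^bsub>M\<^esub> (N +>\<^bsub>M\<^esub> w) = N +>\<^bsub>M\<^esub> (v \<oplus>\<^bsub>M\<^esub> w)"
  using abelian_subgroup.a_rcos_sum[OF submodule_abelian_subgroup[OF assms(1)]] assms by simp

lemma quotient_module_is_module:
  assumes "LinearCombinations.submodule R N M"
  shows "module R (quotient_module M N)"
proof -
  interpret S: LinearCombinations.submodule R N M by fact
  interpret module R M by (rule S.module)
  show ?thesis
    by (rule module_surj_image[OF S.module, where q = "\<lambda>v. N +>\<^bsub>M\<^esub> v"])
      (simp_all add: coset_eq_zero_iff[OF assms] coset_add[OF assms] coset_smult[OF assms])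
qed

lemma quotient_map_hom:
  assumes "LinearCombinations.submodule R N M"
  shows "(\<lambda>v. N +>\<^bsub>M\<^esub> v) \<in> module_hom R M (quotient_module M N)"
  by (auto simp: module_hom_def coset_add[OF assms] coset_smult[OF assms])

subsection \<open>Modules of homomorphisms\<close>

lemma hom_module_simps [simp]:
  "carrier (hom_module R M N) = module_hom R M N \<inter> extensional (carrier M)"
  "\<zero>\<^bsub>hom_module R M N\<^esub> = (\<lambda>v \<in> carrier M. \<zero>\<^bsub>N\<^esub>)"
  "f \<oplus>\<^bsub>hom_module R M N\<^esub> g = (\<lambda>v \<in> carrier M. f v \<oplus>\<^bsub>N\<^esub> g v)"
  "r \<odot>\<^bsub>hom_module R M N\<^esub> f = (\<lambda>v \<in> carrier M. r \<odot>\<^bsub>N\<^esub> f v)"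
  by (simp_all add: hom_module_def)

lemma module_hom_pointwise:
  assumes "module R M" "module R N"
  shows module_hom_zero: "(\<lambda>v. \<zero>\<^bsub>N\<^esub>) \<in> module_hom R M N"
    and module_hom_plus: "\<lbrakk>f \<in> module_hom R M N; g \<in> module_hom R M N\<rbrakk> \<Longrightarrow>
      (\<lambda>v. f v \<oplus>\<^bsub>N\<^esub> g v) \<in> module_hom R M N"
    and module_hom_scale: "\<lbrakk>r \<in> carrier R; f \<in> module_hom R M N\<rbrakk> \<Longrightarrow>
      (\<lambda>v. r \<odot>\<^bsub>N\<^esub> f v) \<in> module_hom R M N"
proof -
  interpret M: module R M by fact
  interpret N: module R N by fact
  show "(\<lambda>v. \<zero>\<^bsub>N\<^esub>) \<in> module_hom R M N" by (auto simp: module_hom_def)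
  show "(\<lambda>v. f v \<oplus>\<^bsub>N\<^esub> g v) \<in> module_hom R M N"
    if "f \<in> module_hom R M N" "g \<in> module_hom R M N"
    using that by (auto simp: module_hom_def Pi_iff N.M.a_ac N.smult_r_distr)
  show "(\<lambda>v. r \<odot>\<^bsub>N\<^esub> f v) \<in> module_hom R M N" if "r \<in> carrier R" "f \<in> module_hom R M N"
    using that
    by (auto simp: module_hom_def Pi_iff N.smult_r_distr M.R.m_comm simp flip: N.smult_assoc1)
qed

lemma hom_module_is_module:
  assumes "module R M" "module R N"
  shows "module R (hom_module R M N)"
proof -
  interpret M: module R M by fact
  interpret N: module R N by fact
  note [simp] = module_hom_restrict[OF assms(1)] module_hom_pointwise[OF assms]
  have [simp]: "f v \<in> carrier N" if "f \<in> module_hom R M N" "v \<in> carrier M" for f v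
    using that by (auto simp: module_hom_def)
  have neg: "\<exists>g\<in>carrier (hom_module R M N). f \<oplus>\<^bsub>hom_module R M N\<^esub> g = \<zero>\<^bsub>hom_module R M N\<^esub>"
    if "f \<in> carrier (hom_module R M N)" for f
  proof
    show "(\<lambda>v\<in>carrier M. (\<ominus>\<^bsub>R\<^esub> \<one>\<^bsub>R\<^esub>) \<odot>\<^bsub>N\<^esub> f v) \<in> carrier (hom_module R M N)" using that by simp
    show "f \<oplus>\<^bsub>hom_module R M N\<^esub> (\<lambda>v\<in>carrier M. (\<ominus>\<^bsub>R\<^esub> \<one>\<^bsub>R\<^esub>) \<odot>\<^bsub>N\<^esub> f v) = \<zero>\<^bsub>hom_module R M N\<^esub>"
      using that by (auto simp: N.smult_minus_1 N.M.r_neg intro!: restrict_ext)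
  qed
  show ?thesis
  proof (rule module_criteria)
    let ?H = "hom_module R M N"
    show "cring R" by (rule M.R.is_cring)
    show "\<zero>\<^bsub>?H\<^esub> \<in> carrier ?H" by simp
    show "\<forall>v w. v \<in> carrier ?H \<and> w \<in> carrier ?H \<longrightarrow> v \<oplus>\<^bsub>?H\<^esub> w \<in> carrier ?H" by simp
    show "\<forall>c v. c \<in> carrier R \<and> v \<in> carrier ?H \<longrightarrow> c \<odot>\<^bsub>?H\<^esub> v \<in> carrier ?H" by simp
    show "\<forall>v w. v \<in> carrier ?H \<and> w \<in> carrier ?H \<longrightarrow> v \<oplus>\<^bsub>?H\<^esub> w = w \<oplus>\<^bsub>?H\<^esub> v"
      by (auto intro!: restrict_ext N.M.a_comm)
    show "\<forall>v w x. v \<in> carrier ?H \<and> w \<in> carrier ?H \<and> x \<in> carrier ?H \<longrightarrow>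
        (v \<oplus>\<^bsub>?H\<^esub> w) \<oplus>\<^bsub>?H\<^esub> x = v \<oplus>\<^bsub>?H\<^esub> (w \<oplus>\<^bsub>?H\<^esub> x)"
      by (auto intro!: restrict_ext N.M.a_assoc)
    show "\<forall>v\<in>carrier ?H. v \<oplus>\<^bsub>?H\<^esub> \<zero>\<^bsub>?H\<^esub> = v"
      by (auto intro!: extensionalityI[of _ "carrier M"])
    show "\<forall>v\<in>carrier ?H. \<one>\<^bsub>R\<^esub> \<odot>\<^bsub>?H\<^esub> v = v"
      by (auto intro!: extensionalityI[of _ "carrier M"])
    show "\<forall>a b v. a \<in> carrier R \<and> b \<in> carrier R \<and> v \<in> carrier ?H \<longrightarrow>
        (a \<otimes>\<^bsub>R\<^esub> b) \<odot>\<^bsub>?H\<^esub> v = a \<odot>\<^bsub>?H\<^esub> (b \<odot>\<^bsub>?H\<^esub> v)"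
      by (auto intro!: restrict_ext simp: N.smult_assoc1)
    show "\<forall>a b v. a \<in> carrier R \<and> b \<in> carrier R \<and> v \<in> carrier ?H \<longrightarrow>
        (a \<oplus>\<^bsub>R\<^esub> b) \<odot>\<^bsub>?H\<^esub> v = a \<odot>\<^bsub>?H\<^esub> v \<oplus>\<^bsub>?H\<^esub> b \<odot>\<^bsub>?H\<^esub> v"
      by (auto intro!: restrict_ext simp: N.smult_l_distr)
    show "\<forall>a v w. a \<in> carrier R \<and> v \<in> carrier ?H \<and> w \<in> carrier ?H \<longrightarrow>
        a \<odot>\<^bsub>?H\<^esub> (v \<oplus>\<^bsub>?H\<^esub> w) = a \<odot>\<^bsub>?H\<^esub> v \<oplus>\<^bsub>?H\<^esub> a \<odot>\<^bsub>?H\<^esub> w"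
      by (auto intro!: restrict_ext simp: N.smult_r_distr)
    show "\<forall>f\<in>carrier (hom_module R M N). \<exists>g\<in>carrier (hom_module R M N).
        f \<oplus>\<^bsub>hom_module R M N\<^esub> g = \<zero>\<^bsub>hom_module R M N\<^esub>"
      using neg by blast
  qed
qed

section \<open>Free modules of finite rank\<close>

definition unit_vector :: "('a, 'r) ring_scheme \<Rightarrow> nat \<Rightarrow> nat \<Rightarrow> nat \<Rightarrow> 'a" where
  "unit_vector R n i = (\<lambda>j\<in>{..<n}. if j = i then \<one>\<^bsub>R\<^esub> else \<zero>\<^bsub>R\<^esub>)"

definition linear_extension ::
    "('a, 'v, 'c) module_scheme \<Rightarrow> nat \<Rightarrow> (nat \<Rightarrow> 'v) \<Rightarrow> (nat \<Rightarrow> 'a) \<Rightarrow> 'v" where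
  "linear_extension M n b c = (\<Oplus>\<^bsub>M\<^esub>i\<in>{..<n}. c i \<odot>\<^bsub>M\<^esub> b i)"

lemma (in ring) func_space_simps [simp]:
  "carrier (func_space S) = S \<rightarrow>\<^sub>E carrier R"
  "\<zero>\<^bsub>func_space S\<^esub> = (\<lambda>i\<in>S. \<zero>)"
  "v \<oplus>\<^bsub>func_space S\<^esub> w = (\<lambda>i\<in>S. v i \<oplus> w i)"
  "r \<odot>\<^bsub>func_space S\<^esub> v = (\<lambda>i\<in>S. r \<otimes> v i)"
  by (simp_all add: func_space_def)

lemma (in cring) unit_vector_closed [simp]: "unit_vector R n i \<in> {..<n} \<rightarrow>\<^sub>E carrier R"
  by (auto simp: unit_vector_def)

context module
begin

lemma linear_extension_hom:
  assumes "b \<in> {..<n} \<rightarrow> carrier M"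
  shows "linear_extension M n b \<in> module_hom R (free_module R n) M"
proof -
  have b [simp]: "i < n \<Longrightarrow> b i \<in> carrier M" for i using assms by auto
  have c: "i < n \<Longrightarrow> c i \<in> carrier R" if "c \<in> {..<n} \<rightarrow>\<^sub>E carrier R" for c i
    using that by auto
  have "linear_extension M n b (\<lambda>i\<in>{..<n}. v i \<oplus> w i) =
      linear_extension M n b v \<oplus>\<^bsub>M\<^esub> linear_extension M n b w"
    if "v \<in> {..<n} \<rightarrow>\<^sub>E carrier R" "w \<in> {..<n} \<rightarrow>\<^sub>E carrier R" for v w
  proof -
    have "linear_extension M n b (\<lambda>i\<in>{..<n}. v i \<oplus> w i) =
        (\<Oplus>\<^bsub>M\<^esub>i\<in>{..<n}. v i \<odot>\<^bsub>M\<^esub> b i \<oplus>\<^bsub>M\<^esub> w i \<odot>\<^bsub>M\<^esub> b i)"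
      unfolding linear_extension_def
      by (rule M.finsum_cong') (auto simp: smult_l_distr c[OF that(1)] c[OF that(2)])
    also have "\<dots> = linear_extension M n b v \<oplus>\<^bsub>M\<^esub> linear_extension M n b w"
      unfolding linear_extension_def
      by (rule M.finsum_addf) (auto simp: c[OF that(1)] c[OF that(2)])
    finally show ?thesis .
  qed
  moreover have "linear_extension M n b (\<lambda>i\<in>{..<n}. r \<otimes> v i) = r \<odot>\<^bsub>M\<^esub> linear_extension M n b v"
    if "r \<in> carrier R" "v \<in> {..<n} \<rightarrow>\<^sub>E carrier R" for r v
  proof -
    have "linear_extension M n b (\<lambda>i\<in>{..<n}. r \<otimes> v i) =
        (\<Oplus>\<^bsub>M\<^esub>i\<in>{..<n}. r \<odot>\<^bsub>M\<^esub> (v i \<odot>\<^bsub>M\<^esub> b i))"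
      unfolding linear_extension_def
      by (rule M.finsum_cong') (auto simp: smult_assoc1 that(1) c[OF that(2)])
    also have "\<dots> = r \<odot>\<^bsub>M\<^esub> linear_extension M n b v"
      unfolding linear_extension_def
      by (rule finsum_smult_ldistr[symmetric]) (auto simp: that(1) c[OF that(2)])
    finally show ?thesis .
  qed
  moreover have "linear_extension M n b v \<in> carrier M" if "v \<in> {..<n} \<rightarrow>\<^sub>E carrier R" for v
    unfolding linear_extension_def by (rule M.finsum_closed) (auto simp: c[OF that])
  ultimately show ?thesis by (auto simp: module_hom_def)
qed

lemma linear_extension_unit:
  assumes "b \<in> {..<n} \<rightarrow> carrier M" "i < n"
  shows "linear_extension M n b (unit_vector R n i) = b i"
proof -
  have b [simp]: "i < n \<Longrightarrow> b i \<in> carrier M" for i using assms by auto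
  have "linear_extension M n b (unit_vector R n i) =
      (\<Oplus>\<^bsub>M\<^esub>j\<in>{..<n}. if i = j then b j else \<zero>\<^bsub>M\<^esub>)"
    unfolding linear_extension_def by (rule M.finsum_cong') (auto simp: unit_vector_def)
  also have "\<dots> = b i" using assms by (intro M.finsum_singleton) auto
  finally show ?thesis .
qed

text \<open>Induction on the number of leading coordinates of \<open>c\<close> that are kept.\<close>
lemma hom_eq_linear_extension:
  assumes f: "f \<in> module_hom R (free_module R n) M" and c: "c \<in> {..<n} \<rightarrow>\<^sub>E carrier R"
  shows "f c = linear_extension M n (\<lambda>i. f (unit_vector R n i)) c"
proof -
  have F: "module R (free_module R n)" by (rule R.func_space_is_module)
  interpret f: mod_hom R "free_module R n" M f
    by (intro mod_hom.intro mod_hom_axioms.intro F module_axioms f)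
  have ci [simp]: "i < n \<Longrightarrow> c i \<in> carrier R" for i using c by auto
  have fu [simp]: "f (unit_vector R n i) \<in> carrier M" for i using f.f_im by simp
  define t where "t k = (\<lambda>j\<in>{..<n}. if j < k then c j else \<zero>)" for k
  have t_closed [simp]: "t k \<in> {..<n} \<rightarrow>\<^sub>E carrier R" for k by (auto simp: t_def)
  have "f (t k) = (\<Oplus>\<^bsub>M\<^esub>i\<in>{..<k}. c i \<odot>\<^bsub>M\<^esub> f (unit_vector R n i))" if "k \<le> n" for k
    using that
  proof (induction k)
    case 0
    have "t 0 = \<zero>\<^bsub>free_module R n\<^esub>" by (simp add: t_def)
    then show ?case using f.f0_is_0 by (simp only: lessThan_0 M.finsum_empty)
  next
    case (Suc k)
    let ?F = "free_module R n" and ?u = "unit_vector R n k"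
    have "t (Suc k) = t k \<oplus>\<^bsub>?F\<^esub> (c k \<odot>\<^bsub>?F\<^esub> ?u)"
      using Suc.prems by (auto simp: t_def unit_vector_def restrict_def fun_eq_iff less_Suc_eq)
    moreover have "t k \<in> carrier ?F" "?u \<in> carrier ?F" "c k \<in> carrier R"
      using Suc.prems by simp_all
    ultimately have "f (t (Suc k)) = f (t k) \<oplus>\<^bsub>M\<^esub> c k \<odot>\<^bsub>M\<^esub> f ?u"
      by (simp only: f.f_add f.f_smult f.M.smult_closed)
    also have "\<dots> = (\<Oplus>\<^bsub>M\<^esub>i\<in>insert k {..<k}. c i \<odot>\<^bsub>M\<^esub> f (unit_vector R n i))"
      using Suc by (subst M.finsum_insert) (auto simp: M.a_comm)
    finally show ?case by (simp add: lessThan_Suc)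
  qed
  from this[OF order_refl] have "f (t n) = (\<Oplus>\<^bsub>M\<^esub>i\<in>{..<n}. c i \<odot>\<^bsub>M\<^esub> f (unit_vector R n i))" .
  moreover have "t n = c"
    using c by (auto simp: t_def fun_eq_iff PiE_def extensional_def)
  ultimately show ?thesis by (simp add: linear_extension_def)
qed

text \<open>Projectivity: the basis vectors are lifted one by one.\<close>
lemma free_module_lift:
  assumes "module R P" and f: "f \<in> module_hom R (free_module R n) M" and g: "g \<in> module_hom R P M"
    and "f ` carrier (free_module R n) \<subseteq> g ` carrier P"
  obtains h where "h \<in> module_hom R (free_module R n) P"
    "\<And>v. v \<in> carrier (free_module R n) \<Longrightarrow> g (h v) = f v"
proof -
  interpret P: module R P by fact
  have "\<exists>p. p \<in> carrier P \<and> g p = f (unit_vector R n i)" for i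
  proof -
    have "f (unit_vector R n i) \<in> g ` carrier P" by (rule subsetD[OF assms(4)]) simp
    then show ?thesis by auto
  qed
  then obtain b where b: "\<And>i. b i \<in> carrier P" "\<And>i. g (b i) = f (unit_vector R n i)"
    by metis
  define h where "h = linear_extension P n b"
  have h: "h \<in> module_hom R (free_module R n) P"
    unfolding h_def using b by (intro P.linear_extension_hom) auto
  have gh: "(\<lambda>v. g (h v)) \<in> module_hom R (free_module R n) M"
    by (rule mod_hom_compose[OF h g])
  have "g (h v) = f v" if "v \<in> carrier (free_module R n)" for v
  proof -
    have v: "v \<in> {..<n} \<rightarrow>\<^sub>E carrier R" using that by simp
    have fu: "f (unit_vector R n i) \<in> carrier M" for i
      using module_hom_closed[OF f] by (auto simp: Pi_iff)
    have "g (h (unit_vector R n i)) = f (unit_vector R n i)" if "i < n" for i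
      using that b by (simp add: h_def P.linear_extension_unit)
    then show ?thesis
      unfolding hom_eq_linear_extension[OF f v] hom_eq_linear_extension[OF gh v]
      unfolding linear_extension_def using fu v by (intro M.finsum_cong') auto
  qed
  with h show thesis by (rule that)
qed

lemma span_eq_image_free:
  assumes "finite A" "A \<subseteq> carrier M"
  obtains n d where "d \<in> module_hom R (free_module R n) M"
    "d ` carrier (free_module R n) = span A"
proof -
  obtain b where b: "bij_betw b {0..<card A} A"
    using ex_bij_betw_nat_finite[OF assms(1)] by auto
  define n where "n = card A"
  have bA: "b ` {..<n} = A" using b by (simp add: bij_betw_def n_def atLeast0LessThan)
  then have b_closed: "b \<in> {..<n} \<rightarrow> carrier M" using assms by auto
  define d where "d = linear_extension M n b"
  have d: "d \<in> module_hom R (free_module R n) M"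
    unfolding d_def by (rule linear_extension_hom[OF b_closed])
  interpret d: mod_hom R "free_module R n" M d
    by (intro mod_hom.intro mod_hom_axioms.intro R.func_space_is_module module_axioms d)
  have sp: "LinearCombinations.submodule R (span A) M" by (rule span_is_submodule[OF assms(2)])
  have "d c \<in> span A" if "c \<in> carrier (free_module R n)" for c
    unfolding d_def linear_extension_def
  proof (rule submodule_finsum_closed[OF sp])
    fix i assume i: "i \<in> {..<n}"
    then have "b i \<in> span A" using bA in_own_span[OF assms(2)] by blast
    moreover have "c i \<in> carrier R" using that i by auto
    ultimately show "c i \<odot>\<^bsub>M\<^esub> b i \<in> span A"
      by (intro LinearCombinations.submodule.smult_closed[OF sp])
  qed
  moreover have "A \<subseteq> d.im"
  proof
    fix a assume "a \<in> A"
    then obtain i where "i < n" "a = b i" using bA by auto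
    then have "a = d (unit_vector R n i)"
      by (simp add: d_def linear_extension_unit[OF b_closed])
    then show "a \<in> d.im" unfolding d.im_def by simp
  qed
  then have "span A \<subseteq> d.im" by (rule span_is_subset[OF _ d.im_is_submodule])
  ultimately have "d ` carrier (free_module R n) = span A" unfolding d.im_def by blast
  with d show thesis by (rule that)
qed

end

section \<open>Free resolutions\<close>

text \<open>Applied to a coordinate function on a free module, whose values on a submodule form an ideal and
  are therefore finitely generated over a noetherian ring.\<close>
lemma submodule_image:
  assumes "LinearCombinations.submodule R N M" "module R P" "f \<in> module_hom R M P"
  shows "LinearCombinations.submodule R (f ` N) P"
proof -
  interpret N: LinearCombinations.submodule R N M by fact
  interpret M: module R M by (rule N.module)
  interpret restr: module R "M\<lparr>carrier := N\<rparr>" by (rule M.submodule_is_module[OF assms(1)])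
  have "f \<in> module_hom R (M\<lparr>carrier := N\<rparr>) P"
    using assms(3) N.subset by (auto simp: module_hom_def Pi_iff subset_iff)
  then interpret f: mod_hom R "M\<lparr>carrier := N\<rparr>" P f
    by (intro mod_hom.intro mod_hom_axioms.intro restr.module_axioms assms)
  show ?thesis using f.im_is_submodule by (simp add: f.im_def)
qed

lemma submodule_regular_ideal:
  assumes "cring R" "LinearCombinations.submodule R J (regular_module R)"
  shows "ideal J R"
proof -
  interpret cring R by fact
  interpret J: LinearCombinations.submodule R J "regular_module R" by fact
  have J: "J \<subseteq> carrier R" "\<zero>\<^bsub>R\<^esub> \<in> J" using J.subset J.zero_closed by auto
  have mult: "r \<otimes>\<^bsub>R\<^esub> v \<in> J" if "r \<in> carrier R" "v \<in> J" for r v using J.smult_closed that by simp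
  have neg: "\<ominus>\<^bsub>R\<^esub> v \<in> J" if "v \<in> J" for v
    using mult[of "\<ominus>\<^bsub>R\<^esub> \<one>\<^bsub>R\<^esub>" v] that J by (auto simp: l_minus subset_iff)
  have add: "v \<oplus>\<^bsub>R\<^esub> w \<in> J" if "v \<in> J" "w \<in> J" for v w
    using J.m_closed that by simp
  have "subgroup J (add_monoid R)"
    using J add neg by (intro add.subgroupI) (auto simp flip: a_inv_def)
  moreover have "v \<otimes>\<^bsub>R\<^esub> r \<in> J" if "r \<in> carrier R" "v \<in> J" for r v
    using m_comm[OF subsetD[OF J(1) that(2)] that(1)] mult[OF that] by (rule ssubst)
  ultimately show ?thesis using mult by (intro idealI ring_axioms)
qed

lemma coordinate_hom:
  assumes "cring R" "k < n"
  shows "(\<lambda>v. v k) \<in> module_hom R (free_module R n) (regular_module R)"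
proof -
  interpret cring R by fact
  show ?thesis using assms(2) by (auto simp: module_hom_def)
qed

text \<open>By induction on the number of coordinates that may be nonzero on \<open>N\<close>: the last of these
  coordinates takes values in a finitely generated ideal, and the vectors on which it vanishes are
  covered by the induction hypothesis.\<close>
lemma submodule_free_finitely_generated:
  fixes R (structure)
  assumes "cring R" "noetherian_ring R" and N: "LinearCombinations.submodule R N (free_module R m)"
  shows "\<exists>A. finite A \<and> A \<subseteq> N \<and> module.span R (free_module R m) A = N"
proof -
  interpret cring R by fact
  interpret noetherian_ring R by fact
  interpret F: module R "free_module R m" by (rule func_space_is_module)
  have "\<exists>A. finite A \<and> A \<subseteq> N \<and> F.span A = N"
    if "LinearCombinations.submodule R N (free_module R m)" "k \<le> m"
      "\<And>v j. v \<in> N \<Longrightarrow> k \<le> j \<Longrightarrow> j < m \<Longrightarrow> v j = \<zero>" for N k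
    using that
  proof (induction k arbitrary: N)
    case 0
    interpret N: LinearCombinations.submodule R N "free_module R m" by (rule 0)
    have "v = \<zero>\<^bsub>free_module R m\<^esub>" if "v \<in> N" for v
      using that N.subset 0(3)[OF that] by (auto simp: fun_eq_iff PiE_def extensional_def)
    then have "N = {\<zero>\<^bsub>free_module R m\<^esub>}" using N.zero_closed by blast
    moreover have "F.span {} = {\<zero>\<^bsub>free_module R m\<^esub>}"
      unfolding F.span_def F.lincomb_def by (auto simp del: func_space_simps)
    ultimately have "F.span {} = N" by simp
    then show ?case by (intro exI[of _ "{}"]) auto
  next
    case (Suc k)
    interpret N: LinearCombinations.submodule R N "free_module R m" by (rule Suc.prems)
    have Nc: "v j \<in> carrier R" if "v \<in> N" "j < m" for v j using that N.subset by auto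
    have coord_hom: "(\<lambda>v. v k) \<in> module_hom R (free_module R m) (regular_module R)"
      using coordinate_hom[OF is_cring] Suc.prems(2) by simp
    have coord_ideal: "ideal ((\<lambda>v. v k) ` N') R"
      if "LinearCombinations.submodule R N' (free_module R m)" for N'
      by (rule submodule_regular_ideal[OF is_cring
            submodule_image[OF that regular_module_is_module[OF is_cring] coord_hom]])
    \<comment> \<open>The \<open>k\<close>-th coordinates of \<open>B\<close> generate those of \<open>N\<close>. Subtracting a combination of \<open>B\<close> takes
      any element of \<open>N\<close> into \<open>N0\<close>, which \<open>A\<close> spans.\<close>
    obtain C where C: "C \<subseteq> carrier R" "finite C" "(\<lambda>v. v k) ` N = Idl C"
      using finetely_gen[OF coord_ideal[OF Suc.prems(1)]] by auto
    then have "C \<subseteq> (\<lambda>v. v k) ` N" using genideal_self by simp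
    then obtain B where B: "B \<subseteq> N" "finite B" "C = (\<lambda>v. v k) ` B"
      using C(2) by (metis finite_subset_image)
    define N0 where "N0 = {v \<in> N. v k = \<zero>}"
    have N0: "LinearCombinations.submodule R N0 (free_module R m)"
      by (rule LinearCombinations.submodule.intro)
        (use N.subset Suc.prems(2) N.m_closed N.smult_closed N.zero_closed
          in \<open>auto simp: N0_def F.module_axioms\<close>)
    have "v j = \<zero>" if "v \<in> N0" "k \<le> j" "j < m" for v j
      using that Suc.prems(3)[of v j] by (cases "j = k") (auto simp: N0_def)
    with Suc.IH[OF N0] Suc.prems(2)
    obtain A where A: "finite A" "A \<subseteq> N0" "F.span A = N0" by auto
    have ABN: "A \<union> B \<subseteq> N" using A B by (auto simp: N0_def)
    then have ABc: "A \<union> B \<subseteq> carrier (free_module R m)" and Bc: "B \<subseteq> carrier (free_module R m)"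
      using N.subset by (blast, blast)
    have AB: "LinearCombinations.submodule R (F.span (A \<union> B)) (free_module R m)"
      by (rule F.span_is_submodule[OF ABc])
    interpret AB: LinearCombinations.submodule R "F.span (A \<union> B)" "free_module R m" by (rule AB)
    have "N \<subseteq> F.span (A \<union> B)"
    proof
      fix v assume v: "v \<in> N"
      have "B \<subseteq> F.span B" using F.in_own_span[OF Bc] .
      then have "Idl C \<subseteq> (\<lambda>v. v k) ` F.span B"
        using B(3) by (intro genideal_minimal coord_ideal F.span_is_submodule[OF Bc]) blast
      moreover have "v k \<in> Idl C" using imageI[OF v, of "\<lambda>v. v k"] unfolding C(3) .
      ultimately have "v k \<in> (\<lambda>v. v k) ` F.span B" by (rule subsetD)
      then obtain w where w: "v k = w k" "w \<in> F.span B" by (rule imageE)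
      have wN: "w \<in> N" by (rule subsetD[OF F.span_is_subset[OF B(1) Suc.prems(1)] w(2)])
      have wAB: "w \<in> F.span (A \<union> B)" by (rule subsetD[OF F.span_is_monotone w(2)]) simp
      have "v \<ominus>\<^bsub>free_module R m\<^esub> w \<in> N" by (rule submodule_minus_closed[OF Suc.prems(1) v wN])
      moreover have "(v \<ominus>\<^bsub>free_module R m\<^esub> w) k = \<zero>"
      proof -
        interpret coord: mod_hom R "free_module R m" "regular_module R" "\<lambda>v. v k"
          by (intro mod_hom.intro mod_hom_axioms.intro F.module_axioms coord_hom
              regular_module_is_module is_cring)
        have "v \<in> carrier (free_module R m)" "w \<in> carrier (free_module R m)"
          using subsetD[OF N.subset v] subsetD[OF N.subset wN] by this
        then have "(v \<ominus>\<^bsub>free_module R m\<^esub> w) k = v k \<ominus>\<^bsub>regular_module R\<^esub> w k"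
          and vk: "v k \<in> carrier (regular_module R)"
          by (simp_all only: coord.f_minus coord.f_im)
        then have "(v \<ominus>\<^bsub>free_module R m\<^esub> w) k = v k \<ominus>\<^bsub>regular_module R\<^esub> v k"
          by (simp only: w(1))
        also have "\<dots> = \<zero>\<^bsub>regular_module R\<^esub>"
          using abelian_group.minus_other_side[OF
              module.axioms(2)[OF regular_module_is_module[OF is_cring]] vk vk] by simp
        finally show ?thesis by simp
      qed
      ultimately have "v \<ominus>\<^bsub>free_module R m\<^esub> w \<in> F.span A" using A(3) by (simp add: N0_def)
      then have "v \<ominus>\<^bsub>free_module R m\<^esub> w \<in> F.span (A \<union> B)"
        by (rule subsetD[OF F.span_is_monotone, rotated]) simp
      from AB.m_closed[OF this wAB] have
        "(v \<ominus>\<^bsub>free_module R m\<^esub> w) \<oplus>\<^bsub>free_module R m\<^esub> w \<in> F.span (A \<union> B)" .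
      moreover have "v \<in> carrier (free_module R m)" "w \<in> carrier (free_module R m)"
        using subsetD[OF N.subset v] subsetD[OF N.subset wN] by this
      then have "(v \<ominus>\<^bsub>free_module R m\<^esub> w) \<oplus>\<^bsub>free_module R m\<^esub> w = v"
        unfolding a_minus_def
        by (simp only: F.M.a_assoc F.M.a_inv_closed F.M.l_neg F.M.r_zero)
      ultimately show "v \<in> F.span (A \<union> B)" by simp
    qed
    with F.span_is_subset[OF ABN Suc.prems(1)] ABN A(1) B(2) show ?case
      by (intro exI[of _ "A \<union> B"]) auto
  qed
  from this[OF N order_refl] show ?thesis by simp
qed

lemma kernel_covered_by_free:
  assumes "cring R" "noetherian_ring R" "module R N" "f \<in> module_hom R (free_module R n) N"
  shows "\<exists>k d. d \<in> module_hom R (free_module R k) (free_module R n) \<and>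
    d ` carrier (free_module R k) = {v \<in> carrier (free_module R n). f v = \<zero>\<^bsub>N\<^esub>}"
proof -
  interpret cring R by fact
  interpret F: module R "free_module R n" by (rule func_space_is_module)
  interpret f: mod_hom R "free_module R n" N f
    by (intro mod_hom.intro mod_hom_axioms.intro F.module_axioms assms)
  obtain A where A: "finite A" "A \<subseteq> f.ker" "F.span A = f.ker"
    using submodule_free_finitely_generated[OF assms(1,2) f.ker_is_submodule] by auto
  have "A \<subseteq> carrier (free_module R n)" using A(2) by (auto simp: f.ker_def)
  then obtain k d where "d \<in> module_hom R (free_module R k) (free_module R n)"
    "d ` carrier (free_module R k) = F.span A"
    by (rule F.span_eq_image_free[OF A(1)])
  then show ?thesis unfolding A(3) f.ker_def by blast
qed

lemma free_resolution_exists: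
  assumes "cring R" "noetherian_ring R" "module R N"
    and \<epsilon>: "\<epsilon> \<in> module_hom R (free_module R n) N" "\<epsilon> ` carrier (free_module R n) = carrier N"
  shows "\<exists>rk d. free_resolution R N rk d \<epsilon>"
proof -
  interpret cring R by fact
  \<comment> \<open>A triple consists of the ranks of source and target of a differential and the differential.\<close>
  define hom where "hom = (\<lambda>(k, n, d). d \<in> module_hom R (free_module R k) (free_module R n))"
  \<comment> \<open>The second triple continues the first: its differential maps onto the kernel of the first one.\<close>
  define syzygy_step where "syzygy_step = (\<lambda>(k, n, d) (k', n', d'). n' = k \<and>
    d' ` carrier (free_module R k') = {v \<in> carrier (free_module R k). d v = \<zero>\<^bsub>free_module R n\<^esub>})"
  obtain k0 d0 where d0: "d0 \<in> module_hom R (free_module R k0) (free_module R n)"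
    "d0 ` carrier (free_module R k0) = {v \<in> carrier (free_module R n). \<epsilon> v = \<zero>\<^bsub>N\<^esub>}"
    using kernel_covered_by_free[OF assms(1-3) \<epsilon>(1)] by auto
  have "\<exists>t. \<forall>i. (hom (t i) \<and> (i = 0 \<longrightarrow> t i = (k0, n, d0))) \<and>
      syzygy_step (t i) (t (Suc i))"
  proof (rule dependent_nat_choice)
    show "\<exists>x. hom x \<and> ((0::nat) = 0 \<longrightarrow> x = (k0, n, d0))"
      unfolding hom_def using d0(1) by simp
  next
    fix x and i :: nat
    assume x: "hom x \<and> (i = 0 \<longrightarrow> x = (k0, n, d0))"
    obtain k l d where x_eq: "x = (k, l, d)" by (rule prod_cases3)
    have d: "d \<in> module_hom R (free_module R k) (free_module R l)"
      using conjunct1[OF x] unfolding x_eq hom_def prod.case .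
    obtain k' d' where d': "d' \<in> module_hom R (free_module R k') (free_module R k)"
      "d' ` carrier (free_module R k') = {v \<in> carrier (free_module R k). d v = \<zero>\<^bsub>free_module R l\<^esub>}"
      using kernel_covered_by_free[OF assms(1,2) func_space_is_module d] by (elim exE conjE)
    show "\<exists>y. (hom y \<and> (Suc i = 0 \<longrightarrow> y = (k0, n, d0))) \<and>
      syzygy_step x y"
      unfolding x_eq hom_def syzygy_step_def
      by (rule exI[of _ "(k', k, d')"]) (simp only: prod.case d' nat.distinct simp_thms)
  qed
  then obtain t where t_all: "\<forall>i. (hom (t i) \<and> (i = 0 \<longrightarrow> t i = (k0, n, d0))) \<and> syzygy_step (t i) (t (Suc i))"
    by (elim exE)
  then have t: "hom (t i)" "t 0 = (k0, n, d0)" "syzygy_step (t i) (t (Suc i))" for i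
    by simp_all
  define rk where "rk i = (case i of 0 \<Rightarrow> n | Suc j \<Rightarrow> fst (t j))" for i
  define d where "d i = snd (snd (t i))" for i
  have target: "fst (snd (t i)) = rk i" for i
    using t(2) t(3)[of "i - 1"] by (cases i) (auto simp: rk_def syzygy_step_def split: prod.splits)
  then have ti: "t i = (rk (Suc i), rk i, d i)" for i
    by (auto simp: d_def rk_def prod_eq_iff)
  have "d n \<in> module_hom R (free_module R (rk (Suc n))) (free_module R (rk n))" for n
    using t(1)[of n] unfolding ti hom_def by simp
  moreover have "d (Suc n) ` carrier (free_module R (rk (Suc (Suc n)))) =
      {v \<in> carrier (free_module R (rk (Suc n))). d n v = \<zero>\<^bsub>free_module R (rk n)\<^esub>}" for n
    using t(3)[of n] unfolding ti syzygy_step_def by simp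
  moreover have "rk 0 = n" "rk 1 = k0" "d 0 = d0" using t(2) unfolding ti by auto
  ultimately have "free_resolution R N rk d \<epsilon>"
    unfolding free_resolution_def Let_def using \<epsilon> d0 by simp
  then show ?thesis by blast
qed

section \<open>Vector spaces over the residue field\<close>

text \<open>If no finite set spans, both dimensions are the least element of the empty set, and so still
  agree.\<close>
lemma dim_eq_of_bij:
  assumes "linear_map K V W T" and bij: "bij_betw T (carrier V) (carrier W)"
  shows "vectorspace.dim K V = vectorspace.dim K W"
proof -
  interpret T: linear_map K V W T by fact
  define S where "S = inv_into (carrier V) T"
  have T_inj: "inj_on T (carrier V)" and T_surj: "T ` carrier V = carrier W"
    using bij by (auto simp: bij_betw_def)
  have S: "bij_betw S (carrier W) (carrier V)" unfolding S_def by (rule bij_betw_inv_into[OF bij])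
  have S_closed: "S w \<in> carrier V" if "w \<in> carrier W" for w
    using S that by (auto simp: bij_betw_def)
  have TS: "T (S w) = w" if "w \<in> carrier W" for w
    unfolding S_def by (rule f_inv_into_f) (simp add: T_surj that)
  have ST: "S w = v" if "T v = w" "v \<in> carrier V" for v w
    using that inv_into_f_f[OF T_inj] by (auto simp: S_def)
  have "S \<in> module_hom K W V"
    unfolding module_hom_def using S_closed
    by (auto intro!: ST simp: TS)
  then have "linear_map K W V S"
    using assms(1) unfolding linear_map_def mod_hom_def mod_hom_axioms_def by blast
  then interpret S: linear_map K W V S .
  show ?thesis
  proof (cases "T.V.fin_dim")
    case True
    then show ?thesis using T.dim_eq[OF _ T_inj T_surj] by simp
  next
    case False
    moreover have "S ` carrier W = carrier V" using S by (simp add: bij_betw_def)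
    ultimately have "\<not> T.W.fin_dim" using S.surj_fin_dim by blast
    with False have
      "\<not> (\<exists>A. finite A \<and> card A = n \<and> A \<subseteq> carrier V \<and> module.span K V A = carrier V)"
      "\<not> (\<exists>A. finite A \<and> card A = n \<and> A \<subseteq> carrier W \<and> module.span K W A = carrier W)" for n
      unfolding T.V.fin_dim_def T.W.fin_dim_def by (blast, blast)
    then show ?thesis unfolding T.V.dim_def T.W.dim_def by (simp only:)
  qed
qed

text \<open>Representatives of a class differ by elements of \<open>m\<close>, which act as zero, so the definite
  description in \<open>residue_module\<close> denotes a unique value.\<close>
lemma residue_smult:
  assumes "cring R" "ideal m R" "module R V"
    and ann: "\<And>a v. a \<in> m \<Longrightarrow> v \<in> carrier V \<Longrightarrow> a \<odot>\<^bsub>V\<^esub> v = \<zero>\<^bsub>V\<^esub>"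
    and r: "r \<in> carrier R" and v: "v \<in> carrier V"
  shows "(m +>\<^bsub>R\<^esub> r) \<odot>\<^bsub>residue_module V\<^esub> v = r \<odot>\<^bsub>V\<^esub> v"
proof -
  interpret m: ideal m R by fact
  interpret module R V by fact
  have "s \<odot>\<^bsub>V\<^esub> v = r \<odot>\<^bsub>V\<^esub> v" if s: "s \<in> m +>\<^bsub>R\<^esub> r" for s
  proof -
    obtain a where a: "a \<in> m" "s = a \<oplus>\<^bsub>R\<^esub> r" using s by (auto simp: a_r_coset_def')
    then have "s \<odot>\<^bsub>V\<^esub> v = a \<odot>\<^bsub>V\<^esub> v \<oplus>\<^bsub>V\<^esub> r \<odot>\<^bsub>V\<^esub> v"
      using r v m.Icarr by (simp add: smult_l_distr)
    then show ?thesis using ann[OF a(1) v] r v by simp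
  qed
  moreover have "r \<in> m +>\<^bsub>R\<^esub> r" by (rule m.a_rcos_self[OF r])
  ultimately have "(THE w. \<exists>s \<in> m +>\<^bsub>R\<^esub> r. w = s \<odot>\<^bsub>V\<^esub> v) = r \<odot>\<^bsub>V\<^esub> v"
    by (intro the_equality) blast+
  then show ?thesis by (simp add: residue_module_def)
qed

lemma residue_module_simps [simp]:
  "carrier (residue_module V) = carrier V"
  "\<zero>\<^bsub>residue_module V\<^esub> = \<zero>\<^bsub>V\<^esub>"
  "add (residue_module V) = add V"
  by (simp_all add: residue_module_def)

lemma residue_module_vectorspace:
  assumes "cring R" "maximalideal m R" "module R V"
    and ann: "\<And>a v. a \<in> m \<Longrightarrow> v \<in> carrier V \<Longrightarrow> a \<odot>\<^bsub>V\<^esub> v = \<zero>\<^bsub>V\<^esub>"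
  shows "vectorspace (R Quot m) (residue_module V)"
proof -
  interpret m: maximalideal m R by fact
  interpret V: module R V by fact
  note smult [simp] = residue_smult[OF assms(1) m.is_ideal assms(3) ann]
  have Q: "\<exists>r \<in> carrier R. c = m +>\<^bsub>R\<^esub> r" if "c \<in> carrier (R Quot m)" for c
    using that by (auto simp: FactRing_def A_RCOSETS_def')
  have add: "(m +>\<^bsub>R\<^esub> r) \<oplus>\<^bsub>R Quot m\<^esub> (m +>\<^bsub>R\<^esub> s) = m +>\<^bsub>R\<^esub> (r \<oplus>\<^bsub>R\<^esub> s)"
    and mult: "(m +>\<^bsub>R\<^esub> r) \<otimes>\<^bsub>R Quot m\<^esub> (m +>\<^bsub>R\<^esub> s) = m +>\<^bsub>R\<^esub> (r \<otimes>\<^bsub>R\<^esub> s)"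
    if "r \<in> carrier R" "s \<in> carrier R" for r s
    using m.rcos_ring_hom that by (auto simp: ring_hom_def)
  have one: "\<one>\<^bsub>R Quot m\<^esub> = m +>\<^bsub>R\<^esub> \<one>\<^bsub>R\<^esub>" by (simp add: FactRing_def)
  show ?thesis
  proof (rule vs_criteria)
    show "field (R Quot m)" by (rule m.quotient_is_field[OF assms(1)])
    show "\<forall>v\<in>carrier (residue_module V). \<exists>w\<in>carrier (residue_module V).
        v \<oplus>\<^bsub>residue_module V\<^esub> w = \<zero>\<^bsub>residue_module V\<^esub>"
      using V.M.r_neg V.M.a_inv_closed by (simp only: residue_module_simps) blast
  qed (auto dest!: Q simp: add mult one V.smult_assoc1 V.smult_l_distr V.smult_r_distr V.M.a_assoc
      intro: V.M.a_comm)
qed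

text \<open>Both \<open>V\<close> and \<open>W\<close> are the quotient of \<open>P\<close> by the common kernel of \<open>\<alpha>\<close> and \<open>\<beta>\<close>.\<close>
lemma residue_dim_eq:
  assumes "cring R" "maximalideal m R" "module R P" "module R V" "module R W"
    and \<alpha>: "\<alpha> \<in> module_hom R P V" "\<alpha> ` carrier P = carrier V"
    and \<beta>: "\<beta> \<in> module_hom R P W" "\<beta> ` carrier P = carrier W"
    and ker: "\<And>p. p \<in> carrier P \<Longrightarrow> \<alpha> p = \<zero>\<^bsub>V\<^esub> \<longleftrightarrow> \<beta> p = \<zero>\<^bsub>W\<^esub>"
    and ann: "\<And>a p. a \<in> m \<Longrightarrow> p \<in> carrier P \<Longrightarrow> \<alpha> (a \<odot>\<^bsub>P\<^esub> p) = \<zero>\<^bsub>V\<^esub>"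
  shows "vectorspace.dim (R Quot m) (residue_module V) = vectorspace.dim (R Quot m) (residue_module W)"
proof -
  interpret m: maximalideal m R by fact
  interpret P: module R P by fact
  interpret \<alpha>: mod_hom R P V \<alpha> by (intro mod_hom.intro mod_hom_axioms.intro assms)
  interpret \<beta>: mod_hom R P W \<beta> by (intro mod_hom.intro mod_hom_axioms.intro assms)
  have eq_iff: "\<alpha> p = \<alpha> q \<longleftrightarrow> \<beta> p = \<beta> q" if "p \<in> carrier P" "q \<in> carrier P" for p q
  proof -
    have "\<alpha> p = \<alpha> q \<longleftrightarrow> \<alpha> (p \<ominus>\<^bsub>P\<^esub> q) = \<zero>\<^bsub>V\<^esub>" using that by simp
    also have "\<dots> \<longleftrightarrow> \<beta> (p \<ominus>\<^bsub>P\<^esub> q) = \<zero>\<^bsub>W\<^esub>" using that by (intro ker P.M.minus_closed)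
    also have "\<dots> \<longleftrightarrow> \<beta> p = \<beta> q" using that by simp
    finally show ?thesis .
  qed
  have annP: "a \<odot>\<^bsub>P\<^esub> p \<in> carrier P" if "a \<in> m" "p \<in> carrier P" for a p
    using that m.Icarr by simp
  have annV: "a \<odot>\<^bsub>V\<^esub> v = \<zero>\<^bsub>V\<^esub>" if av: "a \<in> m" "v \<in> carrier V" for a v
  proof -
    obtain p where "p \<in> carrier P" "v = \<alpha> p" using \<alpha>(2) av by auto
    then show ?thesis using ann[of a p] av m.Icarr by simp
  qed
  have annW: "a \<odot>\<^bsub>W\<^esub> v = \<zero>\<^bsub>W\<^esub>" if av: "a \<in> m" "v \<in> carrier W" for a v
  proof -
    obtain p where p: "p \<in> carrier P" "v = \<beta> p" using \<beta>(2) av by auto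
    then have "\<beta> (a \<odot>\<^bsub>P\<^esub> p) = \<zero>\<^bsub>W\<^esub>" using ann[of a p] ker[OF annP] av by blast
    then show ?thesis using p av m.Icarr by simp
  qed
  define T where "T v = \<beta> (inv_into (carrier P) \<alpha> v)" for v
  have T: "T (\<alpha> p) = \<beta> p" if "p \<in> carrier P" for p
  proof -
    have "\<alpha> p \<in> \<alpha> ` carrier P" using that by (rule imageI)
    from f_inv_into_f[OF this] eq_iff[OF inv_into_into[OF this] that]
    show ?thesis unfolding T_def by blast
  qed
  have lift: "\<exists>p \<in> carrier P. v = \<alpha> p" if "v \<in> carrier V" for v
    using that unfolding \<alpha>(2)[symmetric] by blast
  have T_add: "T (v \<oplus>\<^bsub>V\<^esub> w) = T v \<oplus>\<^bsub>W\<^esub> T w" if vw: "v \<in> carrier V" "w \<in> carrier V" for v w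
  proof -
    obtain p where p: "p \<in> carrier P" "v = \<alpha> p" using lift[OF vw(1)] by blast
    obtain q where q: "q \<in> carrier P" "w = \<alpha> q" using lift[OF vw(2)] by blast
    show ?thesis using T[of "p \<oplus>\<^bsub>P\<^esub> q"] T[OF p(1)] T[OF q(1)] p q by simp
  qed
  have T_smult: "T (r \<odot>\<^bsub>V\<^esub> v) = r \<odot>\<^bsub>W\<^esub> T v" if rv: "r \<in> carrier R" "v \<in> carrier V" for r v
  proof -
    obtain p where p: "p \<in> carrier P" "v = \<alpha> p" using lift[OF rv(2)] by blast
    show ?thesis using T[of "r \<odot>\<^bsub>P\<^esub> p"] T[OF p(1)] p rv by simp
  qed
  have T_image: "T ` carrier V = carrier W"
    unfolding \<alpha>(2)[symmetric] \<beta>(2)[symmetric] image_image by (rule image_cong) (simp_all add: T)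
  have T_inj: "inj_on T (carrier V)"
  proof (rule inj_onI)
    fix v w assume vw: "v \<in> carrier V" "w \<in> carrier V" and eq: "T v = T w"
    obtain p where p: "p \<in> carrier P" "v = \<alpha> p" using lift[OF vw(1)] by blast
    obtain q where q: "q \<in> carrier P" "w = \<alpha> q" using lift[OF vw(2)] by blast
    show "v = w" using eq_iff[OF p(1) q(1)] eq unfolding p(2) q(2) T[OF p(1)] T[OF q(1)] by blast
  qed
  have T_closed: "T v \<in> carrier W" if "v \<in> carrier V" for v using T_image that by blast
  have T_residue: "T (c \<odot>\<^bsub>residue_module V\<^esub> v) = c \<odot>\<^bsub>residue_module W\<^esub> T v"
    if c: "c \<in> carrier (R Quot m)" and v: "v \<in> carrier V" for c v
  proof -
    obtain r where r: "r \<in> carrier R" "c = m +>\<^bsub>R\<^esub> r"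
      using c by (auto simp: FactRing_def A_RCOSETS_def')
    have "c \<odot>\<^bsub>residue_module V\<^esub> v = r \<odot>\<^bsub>V\<^esub> v"
      unfolding r(2) by (rule residue_smult[OF assms(1) m.is_ideal assms(4) annV r(1) v])
    moreover have "c \<odot>\<^bsub>residue_module W\<^esub> T v = r \<odot>\<^bsub>W\<^esub> T v"
      unfolding r(2)
      by (rule residue_smult[OF assms(1) m.is_ideal assms(5) annW r(1) T_closed[OF v]])
    ultimately show ?thesis using T_smult[OF r(1) v] by simp
  qed
  have hom: "T \<in> module_hom (R Quot m) (residue_module V) (residue_module W)"
    unfolding module_hom_def using T_closed T_add T_residue by auto
  have V: "vectorspace (R Quot m) (residue_module V)"
    by (rule residue_module_vectorspace[OF assms(1,2,4) annV])
  have W: "vectorspace (R Quot m) (residue_module W)"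
    by (rule residue_module_vectorspace[OF assms(1,2,5) annW])
  have "linear_map (R Quot m) (residue_module V) (residue_module W) T"
    using V W hom unfolding linear_map_def mod_hom_def mod_hom_axioms_def vectorspace_def by blast
  then show ?thesis
    by (rule dim_eq_of_bij) (simp add: bij_betw_def T_inj T_image)
qed

section \<open>Krull dimensions\<close>

lemma primeideal_vimage:
  assumes "cring R" "ring_hom_ring R S h" "primeideal p S"
  shows "primeideal {r \<in> carrier R. h r \<in> p} R"
proof -
  interpret ring_hom_ring R S h by fact
  interpret p: primeideal p S by fact
  show ?thesis
  proof (rule primeidealI)
    show "ideal {r \<in> carrier R. h r \<in> p} R" by (rule ideal_vimage[OF p.is_ideal])
    show "cring R" by fact
    show "carrier R \<noteq> {r \<in> carrier R. h r \<in> p}"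
    proof
      assume "carrier R = {r \<in> carrier R. h r \<in> p}"
      then have "\<one>\<^bsub>R\<^esub> \<in> {r \<in> carrier R. h r \<in> p}" using R.one_closed by blast
      then have "\<one>\<^bsub>S\<^esub> \<in> p" by simp
      then show False using p.one_imp_carrier p.I_notcarr by auto
    qed
    show "a \<in> {r \<in> carrier R. h r \<in> p} \<or> b \<in> {r \<in> carrier R. h r \<in> p}"
      if "a \<in> carrier R" "b \<in> carrier R" "a \<otimes>\<^bsub>R\<^esub> b \<in> {r \<in> carrier R. h r \<in> p}" for a b
      using that p.I_prime[of "h a" "h b"] by auto
  qed
qed

text \<open>Preimages of primes under a surjection form a chain of the same length.\<close>
lemma krull_dim_surj_le:
  assumes "cring R" "ring_hom_ring R S h" and surj: "h ` carrier R = carrier S"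
  shows "krull_dim S \<le> krull_dim R"
  unfolding krull_dim_def
proof (rule Sup_subset_mono, safe)
  fix n and p :: "nat \<Rightarrow> _"
  assume prime: "\<forall>i\<le>n. primeideal (p i) S" and chain: "\<forall>i<n. p i \<subset> p (Suc i)"
  let ?q = "\<lambda>i. {r \<in> carrier R. h r \<in> p i}"
  have q_prime: "primeideal (?q i) R" if "i \<le> n" for i
    by (rule primeideal_vimage[OF assms(1,2)]) (use prime that in auto)
  have q_chain: "?q i \<subset> ?q (Suc i)" if i: "i < n" for i
  proof -
    obtain s where s: "s \<in> p (Suc i)" "s \<notin> p i" using chain i by blast
    have "primeideal (p (Suc i)) S" using prime i by auto
    then have "s \<in> carrier S"
      using s(1) by (meson ideal.Icarr primeideal.axioms(1))
    then obtain r where "r \<in> carrier R" "s = h r" using surj by auto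
    then have "r \<in> ?q (Suc i)" "r \<notin> ?q i" using s by auto
    moreover have "?q i \<subseteq> ?q (Suc i)" using chain i by auto
    ultimately show ?thesis by blast
  qed
  show "\<exists>n'. enat n = enat n' \<and> (\<exists>p. (\<forall>i\<le>n'. primeideal (p i) R) \<and> (\<forall>i<n'. p i \<subset> p (Suc i)))"
    by (intro exI[of _ n] exI[of _ ?q] conjI refl allI impI q_prime q_chain)
qed

lemma carrier_Quot: "carrier (R Quot I) = (\<lambda>r. I +>\<^bsub>R\<^esub> r) ` carrier R"
  by (auto simp: FactRing_def A_RCOSETS_def')

text \<open>The projection and its inverse are both surjective, so \<open>krull_dim_surj_le\<close> applies in both
  directions.\<close>
lemma krull_dim_quotient_zero:
  assumes "cring R"
  shows "krull_dim (R Quot {\<zero>\<^bsub>R\<^esub>}) = krull_dim R"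
proof -
  interpret cring R by fact
  interpret Z: ideal "{\<zero>\<^bsub>R\<^esub>}" R by (rule zeroideal)
  define S where "S = R Quot {\<zero>\<^bsub>R\<^esub>}"
  define h where "h = (\<lambda>r. {\<zero>\<^bsub>R\<^esub>} +>\<^bsub>R\<^esub> r)"
  have S: "cring S" unfolding S_def by (rule Z.quotient_is_cring) fact
  have hom: "ring_hom_ring R S h" unfolding S_def h_def by (rule Z.rcos_ring_hom_ring)
  interpret h: ring_hom_ring R S h by (rule hom)
  have h_eq: "h r = {r}" if "r \<in> carrier R" for r
    using that by (auto simp: h_def a_r_coset_def')
  have surj: "h ` carrier R = carrier S"
    unfolding S_def h_def by (rule carrier_Quot[symmetric])
  have inj: "inj_on h (carrier R)" using h_eq by (auto simp: inj_on_def)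
  have iso: "h \<in> ring_iso R S"
    using h.homh surj inj by (auto simp: ring_iso_def bij_betw_def)
  define g where "g = inv_into (carrier R) h"
  have "g \<in> ring_iso S R" unfolding g_def by (rule ring_iso_set_sym[OF ring_axioms iso])
  then have g: "g \<in> ring_hom S R" "g ` carrier S = carrier R"
    by (auto simp: ring_iso_def bij_betw_def)
  then have "ring_hom_ring S R g"
    by (intro ring_hom_ringI2 ring_axioms h.S.ring_axioms)
  from krull_dim_surj_le[OF S this g(2)] krull_dim_surj_le[OF assms hom surj]
  show ?thesis by (simp add: S_def)
qed

text \<open>A prime containing \<open>I\<close> contains the radical \<open>m\<close>, hence is \<open>m\<close>; so no two primes of the
  quotient are properly nested.\<close>
lemma krull_dim_quotient_primary_maximal:
  assumes "cring R" "ideal I R" "maximalideal m R" "radical R I = m"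
  shows "krull_dim (R Quot I) = 0"
proof -
  interpret cring R by fact
  interpret I: ideal I R by fact
  interpret m: maximalideal m R by fact
  let ?S = "R Quot I" and ?h = "\<lambda>r. I +>\<^bsub>R\<^esub> r"
  have hom: "ring_hom_ring R ?S ?h" by (rule I.rcos_ring_hom_ring)
  have surj: "?h ` carrier R = carrier ?S" by (rule carrier_Quot[symmetric])
  have vimage_eq: "{r \<in> carrier R. ?h r \<in> p} = m" if p: "primeideal p ?S" for p
  proof -
    let ?P = "{r \<in> carrier R. ?h r \<in> p}"
    interpret P: primeideal ?P R by (rule primeideal_vimage[OF assms(1) hom p])
    have IP: "I \<subseteq> ?P"
    proof
      fix a assume a: "a \<in> I"
      have "\<zero>\<^bsub>?S\<^esub> = I" by (simp only: FactRing_def ring.simps)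
      then have "?h a = \<zero>\<^bsub>?S\<^esub>" using I.a_rcos_const[OF a] by (simp only:)
      moreover have "\<zero>\<^bsub>?S\<^esub> \<in> p"
        using p by (meson additive_subgroup.zero_closed ideal.axioms(1) primeideal.axioms(1))
      ultimately show "a \<in> ?P" using I.Icarr[OF a] by (simp only: mem_Collect_eq)
    qed
    have "a \<in> ?P" if am: "a \<in> m" for a
    proof -
      from am have "a \<in> carrier R \<and> (\<exists>n::nat. a [^]\<^bsub>R\<^esub> n \<in> I)"
        unfolding assms(4)[symmetric] radical_def mem_Collect_eq .
      then have a: "a \<in> carrier R" and "\<exists>n::nat. a [^]\<^bsub>R\<^esub> n \<in> I" by (rule conjunct1, rule conjunct2)
      then obtain n :: nat where "a [^]\<^bsub>R\<^esub> n \<in> I" by (elim exE)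
      then have "a [^]\<^bsub>R\<^esub> n \<in> ?P" by (rule subsetD[OF IP])
      then show ?thesis
      proof (induction n)
        case 0
        then have one: "\<one>\<^bsub>R\<^esub> \<in> ?P" by (simp only: nat_pow_0)
        show ?case by (rule notE[OF P.I_notcarr P.one_imp_carrier[OF one, symmetric]])
      next
        case (Suc n)
        then have "a [^]\<^bsub>R\<^esub> n \<otimes>\<^bsub>R\<^esub> a \<in> ?P" by (simp only: nat_pow_Suc)
        from P.I_prime[OF nat_pow_closed[OF a] a this] Suc.IH show ?case by (elim disjE)
      qed
    qed
    then have "m \<subseteq> ?P" by blast
    moreover have "?P \<subseteq> carrier R" by blast
    ultimately have "?P = m \<or> ?P = carrier R" by (rule m.I_maximal[OF P.is_ideal])
    then show "?P = m"
    proof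
      assume "?P = carrier R"
      then show ?thesis by (rule notE[OF P.I_notcarr sym])
    qed
  qed
  have inj: "p = q" if "primeideal p ?S" "primeideal q ?S" for p q
  proof -
    have "p \<subseteq> carrier ?S" "q \<subseteq> carrier ?S"
      using that(1,2)[THEN primeideal.axioms(1)] by (auto intro: ideal.Icarr)
    moreover have "?h r \<in> p \<longleftrightarrow> ?h r \<in> q" if "r \<in> carrier R" for r
      using that vimage_eq[OF \<open>primeideal p ?S\<close>] vimage_eq[OF \<open>primeideal q ?S\<close>] by blast
    ultimately show ?thesis unfolding surj[symmetric] by blast
  qed
  have "n = 0" if "\<forall>i\<le>n. primeideal (p i) ?S" "\<forall>i<n. p i \<subset> p (Suc i)" for n and p :: "nat \<Rightarrow> _"
  proof (rule ccontr)
    assume "n \<noteq> 0"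
    then have "p 0 \<subset> p 1" "primeideal (p 0) ?S" "primeideal (p 1) ?S" using that by auto
    then show False using inj by blast
  qed
  then have "krull_dim ?S \<le> 0"
    unfolding krull_dim_def by (intro Sup_least) (auto simp: zero_enat_def)
  then show ?thesis by simp
qed

lemma nonzerodivisor_power:
  assumes "cring R" "nonzerodivisor R x"
  shows "nonzerodivisor R (x [^]\<^bsub>R\<^esub> (n::nat))"
proof -
  interpret cring R by fact
  have x: "x \<in> carrier R" using assms(2) by (simp add: nonzerodivisor_def)
  show ?thesis
  proof (induction n)
    case 0
    then show ?case by (simp add: nonzerodivisor_def)
  next
    case (Suc n)
    let ?y = "x [^]\<^bsub>R\<^esub> n"
    have "z = \<zero>\<^bsub>R\<^esub>" if z: "z \<in> carrier R" "(?y \<otimes>\<^bsub>R\<^esub> x) \<otimes>\<^bsub>R\<^esub> z = \<zero>\<^bsub>R\<^esub>" for z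
    proof -
      have "?y \<otimes>\<^bsub>R\<^esub> (x \<otimes>\<^bsub>R\<^esub> z) = \<zero>\<^bsub>R\<^esub>"
        using z x by (simp add: m_assoc)
      then have "x \<otimes>\<^bsub>R\<^esub> z = \<zero>\<^bsub>R\<^esub>"
        using Suc.IH x z(1) unfolding nonzerodivisor_def by blast
      then show ?thesis using assms(2) z(1) unfolding nonzerodivisor_def by blast
    qed
    then show ?case using x by (simp add: nonzerodivisor_def)
  qed
qed

lemma annihilator_ideal_with_nonzerodivisor:
  assumes "cring R" "ideal I R" "y \<in> I" "nonzerodivisor R y"
  shows "annihilator R ((regular_module R)\<lparr>carrier := I\<rparr>) = {\<zero>\<^bsub>R\<^esub>}"
proof -
  interpret cring R by fact
  interpret I: ideal I R by fact
  have "r = \<zero>\<^bsub>R\<^esub>" if "r \<in> carrier R" "r \<otimes>\<^bsub>R\<^esub> y = \<zero>\<^bsub>R\<^esub>" for r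
  proof -
    have "y \<otimes>\<^bsub>R\<^esub> r = \<zero>\<^bsub>R\<^esub>"
      using m_comm[OF that(1) I.Icarr[OF assms(3)]] that(2) by (simp only:)
    then show ?thesis using assms(4) that(1) unfolding nonzerodivisor_def by blast
  qed
  moreover have "annihilator R ((regular_module R)\<lparr>carrier := I\<rparr>) =
      {r \<in> carrier R. \<forall>v\<in>I. r \<otimes>\<^bsub>R\<^esub> v = \<zero>\<^bsub>R\<^esub>}"
    by (simp add: annihilator_def)
  moreover have "\<forall>v\<in>I. \<zero>\<^bsub>R\<^esub> \<otimes>\<^bsub>R\<^esub> v = \<zero>\<^bsub>R\<^esub>" using I.Icarr by simp
  ultimately show ?thesis using assms(3) zero_closed by blast
qed

lemma annihilator_quotient:
  assumes "cring R" "ideal I R"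
  shows "annihilator R (quotient_module (regular_module R) I) = I"
proof -
  interpret cring R by fact
  interpret I: ideal I R by fact
  note sub = ideal_is_submodule[OF assms]
  have coset: "r \<odot>\<^bsub>quotient_module (regular_module R) I\<^esub> (I +>\<^bsub>regular_module R\<^esub> v) = I \<longleftrightarrow>
      r \<otimes>\<^bsub>R\<^esub> v \<in> I" if "r \<in> carrier R" "v \<in> carrier R" for r v
    using that coset_smult[OF sub, of r v] coset_eq_zero_iff[OF sub, of "r \<otimes>\<^bsub>R\<^esub> v"] by simp
  have "r \<in> I" if "r \<in> carrier R" "\<forall>v\<in>carrier R. r \<otimes>\<^bsub>R\<^esub> v \<in> I" for r
    using bspec[OF that(2) one_closed] that(1) by simp
  moreover have "annihilator R (quotient_module (regular_module R) I) =
      {r \<in> carrier R. \<forall>v\<in>carrier R. r \<otimes>\<^bsub>R\<^esub> v \<in> I}"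
    by (simp add: annihilator_def coset cong: conj_cong)
  moreover have "r \<otimes>\<^bsub>R\<^esub> v \<in> I" "r \<in> carrier R" if "r \<in> I" "v \<in> carrier R" for r v
    using I.I_r_closed[OF that] I.Icarr[OF that(1)] by auto
  ultimately show ?thesis by blast
qed

section \<open>Cohomology of the Hom complex\<close>

lemma module_hom_apply [simp]:
  assumes "f \<in> module_hom R M N" "v \<in> carrier M"
  shows "f v \<in> carrier N"
  using assms by (auto simp: module_hom_def)

lemma module_hom_apply_zero:
  assumes "module R M" "module R N" "f \<in> module_hom R M N"
  shows "f \<zero>\<^bsub>M\<^esub> = \<zero>\<^bsub>N\<^esub>"
  by (rule mod_hom.f0_is_0[OF mod_hom.intro[OF assms(1,2) mod_hom_axioms.intro[OF assms(3)]]])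

lemma module_hom_apply_minus:
  assumes "module R M" "module R N" "f \<in> module_hom R M N" "v \<in> carrier M" "w \<in> carrier M"
  shows "f (v \<ominus>\<^bsub>M\<^esub> w) = f v \<ominus>\<^bsub>N\<^esub> f w"
  by (rule mod_hom.f_minus[OF mod_hom.intro[OF assms(1,2) mod_hom_axioms.intro[OF assms(3)]] assms(4,5)])

lemma module_hom_codomain_iff:
  assumes "K \<subseteq> carrier N"
  shows "f \<in> module_hom R M (N\<lparr>carrier := K\<rparr>) \<longleftrightarrow> f \<in> module_hom R M N \<and> (\<forall>v\<in>carrier M. f v \<in> K)"
proof -
  have "f \<in> carrier M \<rightarrow> K \<longleftrightarrow> f \<in> carrier M \<rightarrow> carrier N \<and> (\<forall>v\<in>carrier M. f v \<in> K)"
    using assms by blast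
  then show ?thesis unfolding module_hom_def by (simp add: conj_ac)
qed

locale free_complex = cring R for R (structure) +
  fixes rk :: "nat \<Rightarrow> nat" and d :: "nat \<Rightarrow> (nat \<Rightarrow> 'a) \<Rightarrow> nat \<Rightarrow> 'a"
  assumes d_hom: "d n \<in> module_hom R (free_module R (rk (Suc n))) (free_module R (rk n))"
    and d_d: "v \<in> carrier (free_module R (rk (Suc (Suc n)))) \<Longrightarrow>
      d n (d (Suc n) v) = \<zero>\<^bsub>free_module R (rk n)\<^esub>"
begin

abbreviation F :: "nat \<Rightarrow> ('a, nat \<Rightarrow> 'a) module" where
  "F n \<equiv> free_module R (rk n)"

lemma F_module: "module R (F n)"
  by (rule func_space_is_module)

lemma d_closed: "v \<in> carrier (F (Suc n)) \<Longrightarrow> d n v \<in> carrier (F n)"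
  using d_hom by (rule module_hom_apply)

lemma precompose_d_hom:
  assumes "module R M"
  shows "(\<lambda>f. compose (carrier (F (Suc n))) f (d n)) \<in>
    module_hom R (hom_module R (F n) M) (hom_module R (F (Suc n)) M)"
proof -
  have "compose (carrier (F (Suc n))) f (d n) \<in> module_hom R (F (Suc n)) M"
    if "f \<in> module_hom R (F n) M" for f
    unfolding compose_def module_hom_restrict[OF F_module] by (rule mod_hom_compose[OF d_hom that])
  then show ?thesis
    unfolding module_hom_def[of R "hom_module R (F n) M"]
    by (simp add: compose_def d_closed Pi_iff fun_eq_iff del: func_space_simps)
qed

lemma mem_cocycles_iff:
  "f \<in> cocycles R rk d M n \<longleftrightarrow> f \<in> module_hom R (F n) M \<and> f \<in> extensional (carrier (F n)) \<and>
    (\<forall>v\<in>carrier (F (Suc n)). f (d n v) = \<zero>\<^bsub>M\<^esub>)"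
  by (auto simp: cocycles_def compose_def fun_eq_iff restrict_def simp del: func_space_simps)

lemma mem_coboundaries_Suc_iff:
  "f \<in> coboundaries R rk d M (Suc n) \<longleftrightarrow>
    (\<exists>g\<in>module_hom R (F n) M. f = (\<lambda>v\<in>carrier (F (Suc n)). g (d n v)))"
proof
  assume "f \<in> coboundaries R rk d M (Suc n)"
  then show "\<exists>g\<in>module_hom R (F n) M. f = (\<lambda>v\<in>carrier (F (Suc n)). g (d n v))"
    by (auto simp: compose_def simp del: func_space_simps)
next
  assume "\<exists>g\<in>module_hom R (F n) M. f = (\<lambda>v\<in>carrier (F (Suc n)). g (d n v))"
  then obtain g where g: "g \<in> module_hom R (F n) M" "f = (\<lambda>v\<in>carrier (F (Suc n)). g (d n v))"
    by (elim bexE)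
  show "f \<in> coboundaries R rk d M (Suc n)"
    unfolding coboundaries.simps
  proof (rule image_eqI)
    show "restrict g (carrier (F n)) \<in> carrier (hom_module R (F n) M)"
      using g(1) by (simp add: module_hom_restrict[OF F_module] del: func_space_simps)
    show "f = compose (carrier (F (Suc n))) (restrict g (carrier (F n))) (d n)"
      unfolding g(2) compose_def by (rule restrict_ext) (simp only: d_closed restrict_apply if_True)
  qed
qed

lemma cocycles_submodule:
  assumes "module R M"
  shows "LinearCombinations.submodule R (cocycles R rk d M n) (hom_module R (F n) M)"
proof -
  interpret \<delta>: mod_hom R "hom_module R (F n) M" "hom_module R (F (Suc n)) M"
    "\<lambda>f. compose (carrier (F (Suc n))) f (d n)"
    by (intro mod_hom.intro mod_hom_axioms.intro precompose_d_hom hom_module_is_module assms F_module)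
  show ?thesis using \<delta>.ker_is_submodule unfolding \<delta>.ker_def cocycles_def .
qed

lemma coboundaries_submodule:
  assumes "module R M"
  shows "LinearCombinations.submodule R (coboundaries R rk d M n) (hom_module R (F n) M)"
proof (cases n)
  case 0
  interpret H: module R "hom_module R (F 0) M" by (rule hom_module_is_module[OF F_module assms])
  show ?thesis
    unfolding 0 coboundaries.simps
    by (rule LinearCombinations.submodule.intro)
      (simp_all add: H.module_axioms del: hom_module_simps)
next
  case (Suc k)
  interpret \<delta>: mod_hom R "hom_module R (F k) M" "hom_module R (F (Suc k)) M"
    "\<lambda>f. compose (carrier (F (Suc k))) f (d k)"
    by (intro mod_hom.intro mod_hom_axioms.intro precompose_d_hom hom_module_is_module assms F_module)
  show ?thesis using \<delta>.im_is_submodule unfolding Suc \<delta>.im_def coboundaries.simps .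
qed

lemma coboundaries_subset_cocycles:
  assumes "module R M"
  shows "coboundaries R rk d M n \<subseteq> cocycles R rk d M n"
proof (cases n)
  case 0
  have "\<zero>\<^bsub>hom_module R (F 0) M\<^esub> \<in> cocycles R rk d M 0"
    by (rule LinearCombinations.submodule.zero_closed[OF cocycles_submodule[OF assms]])
  then show ?thesis by (simp add: 0 del: hom_module_simps)
next
  case (Suc k)
  show ?thesis
  proof
    fix f assume f: "f \<in> coboundaries R rk d M n"
    then obtain g where g: "g \<in> module_hom R (F k) M" "f = (\<lambda>v\<in>carrier (F n). g (d k v))"
      unfolding Suc mem_coboundaries_Suc_iff by (elim bexE)
    have "f \<in> module_hom R (F n) M"
      unfolding g(2) module_hom_restrict[OF F_module] Suc by (rule mod_hom_compose[OF d_hom g(1)])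
    moreover have "f (d n v) = \<zero>\<^bsub>M\<^esub>" if v: "v \<in> carrier (F (Suc n))" for v
      using d_closed[OF v] d_d[OF v[unfolded Suc]] module_hom_apply_zero[OF F_module assms g(1)]
      unfolding g(2) by (simp add: Suc del: func_space_simps)
    ultimately show "f \<in> cocycles R rk d M n"
      unfolding mem_cocycles_iff by (simp add: g(2))
  qed
qed

abbreviation cocycle_module :: "('a, 'v, 'c) module_scheme \<Rightarrow> nat \<Rightarrow> ('a, (nat \<Rightarrow> 'a) \<Rightarrow> 'v) module" where
  "cocycle_module M n \<equiv> (hom_module R (F n) M)\<lparr>carrier := cocycles R rk d M n\<rparr>"

lemma coboundaries_submodule_cocycles:
  assumes "module R M"
  shows "LinearCombinations.submodule R (coboundaries R rk d M n) (cocycle_module M n)"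
  by (rule submodule_restrict[OF cocycles_submodule coboundaries_submodule
        coboundaries_subset_cocycles]) fact+

lemma hom_cohomology_module:
  assumes "module R M"
  shows "module R (hom_cohomology R rk d M n)"
  unfolding hom_cohomology_def
  by (rule quotient_module_is_module[OF coboundaries_submodule_cocycles[OF assms]])

text \<open>The form in which cohomology modules are compared below: a homomorphism \<open>\<phi>\<close> into the cochains
  whose values are cocycles, followed by passage to cohomology classes.\<close>
lemma cohomology_class_map:
  assumes M: "module R M" and \<phi>: "\<phi> \<in> module_hom R P (hom_module R (F n) M)"
    and subset: "\<phi> ` carrier P \<subseteq> cocycles R rk d M n"
  defines "cl \<equiv> \<lambda>p. coboundaries R rk d M n +>\<^bsub>cocycle_module M n\<^esub> \<phi> p"
  shows cohomology_class_hom: "cl \<in> module_hom R P (hom_cohomology R rk d M n)"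
    and cohomology_class_zero_iff: "p \<in> carrier P \<Longrightarrow>
      cl p = \<zero>\<^bsub>hom_cohomology R rk d M n\<^esub> \<longleftrightarrow> \<phi> p \<in> coboundaries R rk d M n"
    and cohomology_class_surj: "cocycles R rk d M n \<subseteq> \<phi> ` carrier P \<Longrightarrow>
      cl ` carrier P = carrier (hom_cohomology R rk d M n)"
proof -
  let ?Z = "cocycle_module M n" and ?B = "coboundaries R rk d M n"
  note sub = coboundaries_submodule_cocycles[OF M, of n]
  have image: "\<phi> p \<in> cocycles R rk d M n" if "p \<in> carrier P" for p
    by (rule subsetD[OF subset imageI[OF that]])
  have "\<phi> \<in> module_hom R P ?Z"
    using \<phi> image
    by (simp only: module_hom_codomain_iff[OF
          LinearCombinations.submodule.subset[OF cocycles_submodule[OF M]]]) simp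
  from mod_hom_compose[OF this quotient_map_hom[OF sub]]
  show "cl \<in> module_hom R P (hom_cohomology R rk d M n)"
    unfolding cl_def hom_cohomology_def .
  show "cl p = \<zero>\<^bsub>hom_cohomology R rk d M n\<^esub> \<longleftrightarrow> \<phi> p \<in> ?B" if "p \<in> carrier P"
    using coset_eq_zero_iff[OF sub, of "\<phi> p"] image[OF that]
    by (simp add: cl_def hom_cohomology_def)
  show "cl ` carrier P = carrier (hom_cohomology R rk d M n)" if "cocycles R rk d M n \<subseteq> \<phi> ` carrier P"
  proof -
    have "\<phi> ` carrier P = cocycles R rk d M n"
      using that image by (intro equalityI image_subsetI)
    then have "cl ` carrier P = (\<lambda>z. ?B +>\<^bsub>?Z\<^esub> z) ` cocycles R rk d M n"
      unfolding cl_def by (simp only: image_image[symmetric, of "\<lambda>z. ?B +>\<^bsub>?Z\<^esub> z" \<phi>])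
    then show ?thesis by (simp add: hom_cohomology_def)
  qed
qed

end

lemma free_resolution_complex:
  assumes "cring R" "free_resolution R N rk d \<epsilon>"
  shows "free_complex R rk d"
proof -
  interpret cring R by fact
  have d: "\<And>n. d n \<in> module_hom R (free_module R (rk (Suc n))) (free_module R (rk n))"
    and ex: "\<And>n. d (Suc n) ` carrier (free_module R (rk (Suc (Suc n)))) =
      {v \<in> carrier (free_module R (rk (Suc n))). d n v = \<zero>\<^bsub>free_module R (rk n)\<^esub>}"
    using assms(2) unfolding free_resolution_def Let_def by blast+
  have "d n (d (Suc n) v) = \<zero>\<^bsub>free_module R (rk n)\<^esub>"
    if "v \<in> carrier (free_module R (rk (Suc (Suc n))))" for n v
    using imageI[OF that, of "d (Suc n)"] unfolding ex by blast
  then show ?thesis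
    by (intro free_complex.intro free_complex_axioms.intro assms(1) d)
qed

text \<open>Multiplication by an element \<open>a\<close> that annihilates the resolved module is null-homotopic on the
  resolution. The first component \<open>s : F\<^sub>0 \<rightarrow> F\<^sub>1\<close> of the homotopy is a lift of multiplication by \<open>a\<close>
  through \<open>d\<^sub>0\<close>; on \<open>F\<^sub>1\<close> the difference \<open>a - s d\<^sub>0\<close> maps into the kernel of \<open>d\<^sub>0\<close>, that is into the
  image of \<open>d\<^sub>1\<close>, where \<open>\<phi>\<close> vanishes. Hence \<open>a \<phi>\<close> is the coboundary of \<open>\<phi> \<circ> s\<close>.\<close>
lemma annihilated_cocycle_is_coboundary:
  assumes "cring R" "module R N" "module R M" "free_resolution R N rk d \<epsilon>"
    and a: "a \<in> carrier R" "\<And>u. u \<in> carrier N \<Longrightarrow> a \<odot>\<^bsub>N\<^esub> u = \<zero>\<^bsub>N\<^esub>"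
    and \<phi>: "\<phi> \<in> module_hom R (free_module R (rk 1)) M"
    and cocycle: "\<And>w. w \<in> carrier (free_module R (rk 2)) \<Longrightarrow> \<phi> (d 1 w) = \<zero>\<^bsub>M\<^esub>"
  shows "\<exists>h\<in>module_hom R (free_module R (rk 0)) M.
    \<forall>v\<in>carrier (free_module R (rk 1)). a \<odot>\<^bsub>M\<^esub> \<phi> v = h (d 0 v)"
proof -
  interpret free_complex R rk d by (rule free_resolution_complex[OF assms(1,4)])
  have \<epsilon>: "\<epsilon> \<in> module_hom R (F 0) N"
    and ex0: "d 0 ` carrier (F 1) = {v \<in> carrier (F 0). \<epsilon> v = \<zero>\<^bsub>N\<^esub>}"
    and ex: "d (Suc n) ` carrier (F (Suc (Suc n))) = {v \<in> carrier (F (Suc n)). d n v = \<zero>\<^bsub>F n\<^esub>}" for n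
    using assms(4) unfolding free_resolution_def Let_def by blast+
  have d0: "d 0 \<in> module_hom R (F 1) (F 0)" using d_hom[of 0] by simp
  have id: "(\<lambda>v. v) \<in> module_hom R (F 0) (F 0)" by (simp add: module_hom_def)
  have mult: "(\<lambda>v. a \<odot>\<^bsub>F 0\<^esub> v) \<in> module_hom R (F 0) (F 0)"
    by (rule module_hom_scale[OF F_module F_module a(1) id])
  have "a \<odot>\<^bsub>F 0\<^esub> v \<in> d 0 ` carrier (F 1)" if v: "v \<in> carrier (F 0)" for v
  proof -
    have "\<epsilon> (a \<odot>\<^bsub>F 0\<^esub> v) = \<zero>\<^bsub>N\<^esub>"
      using module_hom_smult[OF \<epsilon> a(1) v] a(2)[OF module_hom_apply[OF \<epsilon> v]] by (simp only:)
    then show ?thesis unfolding ex0 using module_hom_apply[OF mult v] by blast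
  qed
  then have "(\<lambda>v. a \<odot>\<^bsub>F 0\<^esub> v) ` carrier (F 0) \<subseteq> d 0 ` carrier (F 1)" by (rule image_subsetI)
  from module.free_module_lift[OF F_module F_module mult d0 this]
  obtain s where s: "s \<in> module_hom R (F 0) (F 1)"
    "\<And>v. v \<in> carrier (F 0) \<Longrightarrow> d 0 (s v) = a \<odot>\<^bsub>F 0\<^esub> v"
    by metis
  have "a \<odot>\<^bsub>M\<^esub> \<phi> v = \<phi> (s (d 0 v))" if v: "v \<in> carrier (F 1)" for v
  proof -
    let ?w = "a \<odot>\<^bsub>F 1\<^esub> v \<ominus>\<^bsub>F 1\<^esub> s (d 0 v)"
    have av: "a \<odot>\<^bsub>F 1\<^esub> v \<in> carrier (F 1)" by (rule module.smult_closed[OF F_module a(1) v])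
    have dv: "d 0 v \<in> carrier (F 0)" by (rule module_hom_apply[OF d0 v])
    have sdv: "s (d 0 v) \<in> carrier (F 1)" by (rule module_hom_apply[OF s(1) dv])
    have adv: "a \<odot>\<^bsub>F 0\<^esub> d 0 v \<in> carrier (F 0)" by (rule module.smult_closed[OF F_module a(1) dv])
    have w: "?w \<in> carrier (F 1)"
      by (rule abelian_group.minus_closed[OF module.axioms(2)[OF F_module] av sdv])
    have "d 0 ?w = a \<odot>\<^bsub>F 0\<^esub> d 0 v \<ominus>\<^bsub>F 0\<^esub> a \<odot>\<^bsub>F 0\<^esub> d 0 v"
      using module_hom_apply_minus[OF F_module F_module d0 av sdv] module_hom_smult[OF d0 a(1) v]
        s(2)[OF dv] by (simp only:)
    also have "\<dots> = \<zero>\<^bsub>F 0\<^esub>"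
      by (rule iffD2[OF abelian_group.minus_other_side[OF module.axioms(2)[OF F_module] adv adv] refl])
    finally have "?w \<in> d 1 ` carrier (F 2)"
      using w ex[of 0] by (simp only: One_nat_def numeral_2_eq_2 mem_Collect_eq)
    then obtain u where "u \<in> carrier (F 2)" "?w = d 1 u" by (elim imageE)
    then have "\<phi> ?w = \<zero>\<^bsub>M\<^esub>" using cocycle by (simp only:)
    then have "\<phi> (a \<odot>\<^bsub>F 1\<^esub> v) \<ominus>\<^bsub>M\<^esub> \<phi> (s (d 0 v)) = \<zero>\<^bsub>M\<^esub>"
      using module_hom_apply_minus[OF F_module assms(3) \<phi> av sdv] by (simp only:)
    then have "\<phi> (a \<odot>\<^bsub>F 1\<^esub> v) = \<phi> (s (d 0 v))"
      using abelian_group.minus_other_side[OF module.axioms(2)[OF assms(3)]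
          module_hom_apply[OF \<phi> av] module_hom_apply[OF \<phi> sdv]] by (simp only:)
    then show ?thesis using module_hom_smult[OF \<phi> a(1) v] by (simp only:)
  qed
  moreover have "(\<lambda>v. \<phi> (s v)) \<in> module_hom R (F 0) M" by (rule mod_hom_compose[OF s(1) \<phi>])
  ultimately show ?thesis by (intro bexI[of _ "\<lambda>v. \<phi> (s v)"] ballI)
qed

section \<open>The vanishing of the map on Ext\<close>

lemma nonzerodivisor_cancel:
  assumes "cring R" "nonzerodivisor R x" "r \<in> carrier R" "s \<in> carrier R"
    and eq: "x \<otimes>\<^bsub>R\<^esub> r = x \<otimes>\<^bsub>R\<^esub> s"
  shows "r = s"
proof -
  interpret cring R by fact
  have x: "x \<in> carrier R" using assms(2) by (simp add: nonzerodivisor_def)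
  have "x \<otimes>\<^bsub>R\<^esub> (r \<ominus>\<^bsub>R\<^esub> s) = x \<otimes>\<^bsub>R\<^esub> r \<ominus>\<^bsub>R\<^esub> x \<otimes>\<^bsub>R\<^esub> s"
    using x assms(3,4) by algebra
  also have "\<dots> = \<zero>\<^bsub>R\<^esub>"
    unfolding eq using x assms(4) by (intro iffD2[OF minus_other_side] m_closed refl)
  finally have "x \<otimes>\<^bsub>R\<^esub> (r \<ominus>\<^bsub>R\<^esub> s) = \<zero>\<^bsub>R\<^esub>" .
  moreover have "\<forall>y\<in>carrier R. x \<otimes>\<^bsub>R\<^esub> y = \<zero>\<^bsub>R\<^esub> \<longrightarrow> y = \<zero>\<^bsub>R\<^esub>"
    using assms(2) unfolding nonzerodivisor_def by (rule conjunct2)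
  ultimately have "r \<ominus>\<^bsub>R\<^esub> s = \<zero>\<^bsub>R\<^esub>" using minus_closed[OF assms(3,4)] by simp
  then show ?thesis using minus_other_side[OF assms(3,4)] by simp
qed

text \<open>The homomorphism \<open>q / x\<close>. Its values are unique since \<open>x\<close> is a nonzerodivisor and \<open>\<iota>\<close> is injective,
  and uniqueness makes it linear.\<close>
lemma frac_colon_hom:
  assumes "total_ring_of_fractions R Q \<iota>" "ideal I R" "nonzerodivisor R x"
    and q: "q \<in> frac_colon R Q \<iota> x I"
  shows "\<exists>\<psi>\<in>module_hom R ((regular_module R)\<lparr>carrier := I\<rparr>) (regular_module R).
    \<forall>a\<in>I. \<iota> (x \<otimes>\<^bsub>R\<^esub> \<psi> a) = q \<otimes>\<^bsub>Q\<^esub> \<iota> a"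
proof -
  interpret total_ring_of_fractions R Q \<iota> by fact
  have x: "x \<in> carrier R" using assms(3) by (simp add: nonzerodivisor_def)
  have Icarr: "a \<in> carrier R" if "a \<in> I" for a by (rule ideal.Icarr[OF assms(2) that])
  have qc: "q \<in> carrier Q" using q by (simp add: frac_colon_def)
  have \<iota>c: "\<iota> r \<in> carrier Q" if "r \<in> carrier R" for r by (rule ring_hom_closed[OF hom that])
  have "\<exists>r. r \<in> carrier R \<and> \<iota> (x \<otimes>\<^bsub>R\<^esub> r) = q \<otimes>\<^bsub>Q\<^esub> \<iota> a" if "a \<in> I" for a
  proof -
    have "q \<otimes>\<^bsub>Q\<^esub> \<iota> a \<in> \<iota> ` (PIdl\<^bsub>R\<^esub> x)" using q that by (simp add: frac_colon_def)
    then obtain y where y: "q \<otimes>\<^bsub>Q\<^esub> \<iota> a = \<iota> y" "y \<in> PIdl\<^bsub>R\<^esub> x" by (rule imageE)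
    then obtain r where "r \<in> carrier R" "y = r \<otimes>\<^bsub>R\<^esub> x" unfolding cgenideal_def by blast
    then show ?thesis using y(1) R.m_comm[OF _ x] by (intro exI[of _ r]) simp
  qed
  then obtain \<psi> where \<psi>: "\<And>a. a \<in> I \<Longrightarrow> \<psi> a \<in> carrier R"
    "\<And>a. a \<in> I \<Longrightarrow> \<iota> (x \<otimes>\<^bsub>R\<^esub> \<psi> a) = q \<otimes>\<^bsub>Q\<^esub> \<iota> a"
    by metis
  have unique: "\<psi> a = r" if "a \<in> I" "r \<in> carrier R" "\<iota> (x \<otimes>\<^bsub>R\<^esub> r) = q \<otimes>\<^bsub>Q\<^esub> \<iota> a" for a r
  proof (rule nonzerodivisor_cancel[OF R.is_cring assms(3) \<psi>(1)[OF that(1)] that(2)])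
    show "x \<otimes>\<^bsub>R\<^esub> \<psi> a = x \<otimes>\<^bsub>R\<^esub> r"
      using \<psi>(2)[OF that(1)] that(3)
      by (intro inj_onD[OF inj] R.m_closed x \<psi>(1) that) simp
  qed
  have "\<psi> (a \<oplus>\<^bsub>R\<^esub> b) = \<psi> a \<oplus>\<^bsub>R\<^esub> \<psi> b" if ab: "a \<in> I" "b \<in> I" for a b
  proof (rule unique)
    show "a \<oplus>\<^bsub>R\<^esub> b \<in> I"
      by (rule additive_subgroup.a_closed[OF ideal.axioms(1)[OF assms(2)] ab])
    show "\<psi> a \<oplus>\<^bsub>R\<^esub> \<psi> b \<in> carrier R" by (intro R.add.m_closed \<psi>(1) ab)
    have "\<iota> (x \<otimes>\<^bsub>R\<^esub> (\<psi> a \<oplus>\<^bsub>R\<^esub> \<psi> b)) = \<iota> (x \<otimes>\<^bsub>R\<^esub> \<psi> a) \<oplus>\<^bsub>Q\<^esub> \<iota> (x \<otimes>\<^bsub>R\<^esub> \<psi> b)"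
      using x \<psi>(1) ab by (simp only: R.r_distr ring_hom_add[OF hom] R.m_closed)
    also have "\<dots> = q \<otimes>\<^bsub>Q\<^esub> (\<iota> a \<oplus>\<^bsub>Q\<^esub> \<iota> b)"
      using qc \<iota>c Icarr ab by (simp only: \<psi>(2) Q.r_distr)
    finally show "\<iota> (x \<otimes>\<^bsub>R\<^esub> (\<psi> a \<oplus>\<^bsub>R\<^esub> \<psi> b)) = q \<otimes>\<^bsub>Q\<^esub> \<iota> (a \<oplus>\<^bsub>R\<^esub> b)"
      using Icarr ab by (simp only: ring_hom_add[OF hom])
  qed
  moreover have "\<psi> (r \<otimes>\<^bsub>R\<^esub> a) = r \<otimes>\<^bsub>R\<^esub> \<psi> a" if ra: "r \<in> carrier R" "a \<in> I" for r a
  proof (rule unique)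
    show "r \<otimes>\<^bsub>R\<^esub> a \<in> I" by (rule ideal.I_l_closed[OF assms(2) ra(2,1)])
    show "r \<otimes>\<^bsub>R\<^esub> \<psi> a \<in> carrier R" by (intro R.m_closed \<psi>(1) ra)
    have "\<iota> (x \<otimes>\<^bsub>R\<^esub> (r \<otimes>\<^bsub>R\<^esub> \<psi> a)) = \<iota> r \<otimes>\<^bsub>Q\<^esub> \<iota> (x \<otimes>\<^bsub>R\<^esub> \<psi> a)"
      using x \<psi>(1) ra by (simp only: R.m_lcomm[of x r] ring_hom_mult[OF hom] R.m_closed)
    also have "\<dots> = q \<otimes>\<^bsub>Q\<^esub> (\<iota> r \<otimes>\<^bsub>Q\<^esub> \<iota> a)"
      using qc \<iota>c Icarr ra by (simp only: \<psi>(2) Q.m_lcomm[of "\<iota> r" q])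
    finally show "\<iota> (x \<otimes>\<^bsub>R\<^esub> (r \<otimes>\<^bsub>R\<^esub> \<psi> a)) = q \<otimes>\<^bsub>Q\<^esub> \<iota> (r \<otimes>\<^bsub>R\<^esub> a)"
      using Icarr ra by (simp only: ring_hom_mult[OF hom])
  qed
  ultimately have "\<psi> \<in> module_hom R ((regular_module R)\<lparr>carrier := I\<rparr>) (regular_module R)"
    using \<psi>(1) by (simp add: module_hom_def Pi_iff)
  then show ?thesis using \<psi>(2) by (intro bexI[of _ \<psi>] ballI)
qed

text \<open>Over \<open>Q\<close> this says that \<open>(s / x) g\<close> is the coboundary \<open>h \<circ> d\<^sub>0\<close>; for \<open>s = x\<close> the coboundary is \<open>g\<close> itself.
  The statement is additive in \<open>s\<close>, so induction over the product reduces it to \<open>s = a q\<close>. There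
  \<open>q / x\<close> turns \<open>g\<close> into an \<open>R\<close>-valued cocycle, and multiplication by \<open>a \<in> m\<close> makes that a
  coboundary.\<close>
lemma ideal_prod_cocycle_bounds:
  assumes Q: "total_ring_of_fractions R Q \<iota>" and I: "ideal I R" and x: "nonzerodivisor R x"
    and res: "module R N" "free_resolution R N rk d \<epsilon>"
    and ann: "m \<subseteq> carrier R" "\<And>a u. a \<in> m \<Longrightarrow> u \<in> carrier N \<Longrightarrow> a \<odot>\<^bsub>N\<^esub> u = \<zero>\<^bsub>N\<^esub>"
    and g: "g \<in> module_hom R (free_module R (rk 1)) ((regular_module R)\<lparr>carrier := I\<rparr>)"
    and cocycle: "\<And>w. w \<in> carrier (free_module R (rk 2)) \<Longrightarrow> g (d 1 w) = \<zero>\<^bsub>R\<^esub>"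
    and s: "s \<in> ideal_prod Q (\<iota> ` m) (frac_colon R Q \<iota> x I)"
  shows "s \<in> carrier Q \<and> (\<exists>h\<in>module_hom R (free_module R (rk 0)) (regular_module R).
    \<forall>v\<in>carrier (free_module R (rk 1)). \<iota> x \<otimes>\<^bsub>Q\<^esub> \<iota> (h (d 0 v)) = s \<otimes>\<^bsub>Q\<^esub> \<iota> (g v))"
proof -
  interpret total_ring_of_fractions R Q \<iota> by (rule Q)
  interpret free_complex R rk d by (rule free_resolution_complex[OF R.is_cring res(2)])
  have xc: "x \<in> carrier R" using x by (simp add: nonzerodivisor_def)
  have \<iota>c: "\<iota> r \<in> carrier Q" if "r \<in> carrier R" for r by (rule ring_hom_closed[OF hom that])
  note reg = regular_module_is_module[OF R.is_cring]
  have gI: "g v \<in> I" if "v \<in> carrier (F 1)" for v using module_hom_apply[OF g that] by simp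
  have Icarr: "a \<in> carrier R" if "a \<in> I" for a by (rule ideal.Icarr[OF I that])
  have IM: "module R ((regular_module R)\<lparr>carrier := I\<rparr>)"
    by (rule module.submodule_is_module[OF reg ideal_is_submodule[OF R.is_cring I]])
  have dv: "d 0 v \<in> carrier (F 0)" if "v \<in> carrier (F 1)" for v using d_closed[of v 0] that by simp
  show ?thesis
    using s
  proof (induction s rule: ideal_prod.induct)
    case (prod i q)
    obtain a where a: "a \<in> m" "i = \<iota> a" using prod(1) by (elim imageE)
    have ac: "a \<in> carrier R" using ann(1) a(1) by (rule subsetD)
    have qc: "q \<in> carrier Q" using prod(2) by (simp add: frac_colon_def)
    obtain \<psi> where \<psi>: "\<psi> \<in> module_hom R ((regular_module R)\<lparr>carrier := I\<rparr>) (regular_module R)"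
      "\<forall>b\<in>I. \<iota> (x \<otimes>\<^bsub>R\<^esub> \<psi> b) = q \<otimes>\<^bsub>Q\<^esub> \<iota> b"
      using frac_colon_hom[OF Q I x prod(2)] by (elim bexE)
    have \<psi>g: "(\<lambda>v. \<psi> (g v)) \<in> module_hom R (F 1) (regular_module R)"
      by (rule mod_hom_compose[OF g \<psi>(1)])
    have "\<psi> \<zero>\<^bsub>R\<^esub> = \<zero>\<^bsub>R\<^esub>" using module_hom_apply_zero[OF IM reg \<psi>(1)] by simp
    then have \<psi>_cocycle: "\<psi> (g (d 1 w)) = \<zero>\<^bsub>regular_module R\<^esub>" if "w \<in> carrier (F 2)" for w
      using cocycle[OF that] by simp
    have "\<exists>h\<in>module_hom R (F 0) (regular_module R).
        \<forall>v\<in>carrier (F 1). a \<odot>\<^bsub>regular_module R\<^esub> \<psi> (g v) = h (d 0 v)"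
      by (rule annihilated_cocycle_is_coboundary[OF R.is_cring res(1) reg res(2) ac _ \<psi>g])
        (rule ann(2)[OF a(1)] \<psi>_cocycle, assumption)+
    then obtain h where h: "h \<in> module_hom R (F 0) (regular_module R)"
      "\<forall>v\<in>carrier (F 1). a \<odot>\<^bsub>regular_module R\<^esub> \<psi> (g v) = h (d 0 v)"
      by (elim bexE)
    have "\<iota> x \<otimes>\<^bsub>Q\<^esub> \<iota> (h (d 0 v)) = (i \<otimes>\<^bsub>Q\<^esub> q) \<otimes>\<^bsub>Q\<^esub> \<iota> (g v)" if v: "v \<in> carrier (F 1)" for v
    proof -
      have \<psi>c: "\<psi> (g v) \<in> carrier R" using module_hom_apply[OF \<psi>g v] by simp
      have "h (d 0 v) = a \<otimes>\<^bsub>R\<^esub> \<psi> (g v)" using bspec[OF h(2) v] by simp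
      then have "\<iota> x \<otimes>\<^bsub>Q\<^esub> \<iota> (h (d 0 v)) = \<iota> x \<otimes>\<^bsub>Q\<^esub> (\<iota> a \<otimes>\<^bsub>Q\<^esub> \<iota> (\<psi> (g v)))"
        by (simp only: ring_hom_mult[OF hom ac \<psi>c])
      also have "\<dots> = \<iota> a \<otimes>\<^bsub>Q\<^esub> \<iota> (x \<otimes>\<^bsub>R\<^esub> \<psi> (g v))"
        by (simp only: Q.m_lcomm[OF \<iota>c[OF xc] \<iota>c[OF ac] \<iota>c[OF \<psi>c]] ring_hom_mult[OF hom xc \<psi>c])
      also have "\<dots> = \<iota> a \<otimes>\<^bsub>Q\<^esub> (q \<otimes>\<^bsub>Q\<^esub> \<iota> (g v))" by (simp only: bspec[OF \<psi>(2) gI[OF v]])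
      finally show ?thesis
        by (simp only: a(2) Q.m_assoc[OF \<iota>c[OF ac] qc \<iota>c[OF Icarr[OF gI[OF v]]]])
    qed
    moreover have "i \<otimes>\<^bsub>Q\<^esub> q \<in> carrier Q" unfolding a(2) by (intro Q.m_closed \<iota>c ac qc)
    ultimately show ?case using h(1) by (intro conjI bexI[of _ h] ballI)
  next
    case (sum s1 s2)
    obtain h1 where s1: "s1 \<in> carrier Q" and h1: "h1 \<in> module_hom R (F 0) (regular_module R)"
      "\<forall>v\<in>carrier (F 1). \<iota> x \<otimes>\<^bsub>Q\<^esub> \<iota> (h1 (d 0 v)) = s1 \<otimes>\<^bsub>Q\<^esub> \<iota> (g v)"
      using sum.IH(1) by (elim conjE bexE)
    obtain h2 where s2: "s2 \<in> carrier Q" and h2: "h2 \<in> module_hom R (F 0) (regular_module R)"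
      "\<forall>v\<in>carrier (F 1). \<iota> x \<otimes>\<^bsub>Q\<^esub> \<iota> (h2 (d 0 v)) = s2 \<otimes>\<^bsub>Q\<^esub> \<iota> (g v)"
      using sum.IH(2) by (elim conjE bexE)
    let ?h = "\<lambda>v. h1 v \<oplus>\<^bsub>regular_module R\<^esub> h2 v"
    have "?h \<in> module_hom R (F 0) (regular_module R)"
      by (rule module_hom_plus[OF F_module reg h1(1) h2(1)])
    moreover have "\<iota> x \<otimes>\<^bsub>Q\<^esub> \<iota> (?h (d 0 v)) = (s1 \<oplus>\<^bsub>Q\<^esub> s2) \<otimes>\<^bsub>Q\<^esub> \<iota> (g v)"
      if v: "v \<in> carrier (F 1)" for v
    proof -
      have c1: "h1 (d 0 v) \<in> carrier R" using module_hom_apply[OF h1(1) dv[OF v]] by simp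
      have c2: "h2 (d 0 v) \<in> carrier R" using module_hom_apply[OF h2(1) dv[OF v]] by simp
      have "\<iota> x \<otimes>\<^bsub>Q\<^esub> \<iota> (?h (d 0 v)) =
          \<iota> x \<otimes>\<^bsub>Q\<^esub> \<iota> (h1 (d 0 v)) \<oplus>\<^bsub>Q\<^esub> \<iota> x \<otimes>\<^bsub>Q\<^esub> \<iota> (h2 (d 0 v))"
        by (simp only: regular_module_simps ring_hom_add[OF hom c1 c2]
            Q.r_distr[OF \<iota>c[OF c1] \<iota>c[OF c2] \<iota>c[OF xc]])
      also have "\<dots> = s1 \<otimes>\<^bsub>Q\<^esub> \<iota> (g v) \<oplus>\<^bsub>Q\<^esub> s2 \<otimes>\<^bsub>Q\<^esub> \<iota> (g v)"
        by (simp only: bspec[OF h1(2) v] bspec[OF h2(2) v])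
      finally show ?thesis by (simp only: Q.l_distr[OF s1 s2 \<iota>c[OF Icarr[OF gI[OF v]]]])
    qed
    moreover have "s1 \<oplus>\<^bsub>Q\<^esub> s2 \<in> carrier Q" by (rule Q.add.m_closed[OF s1 s2])
    ultimately show ?case by (intro conjI bexI[of _ ?h] ballI)
  qed
qed

text \<open>This is the vanishing of \<open>Ext\<^sup>1(N, I) \<rightarrow> Ext\<^sup>1(N, R)\<close> for a module \<open>N\<close>
  annihilated by \<open>m\<close>: the case \<open>s = x\<close> of the preceding lemma, divided by \<open>x\<close>.\<close>
lemma cocycle_into_ideal_is_coboundary:
  assumes Q: "total_ring_of_fractions R Q \<iota>" and I: "ideal I R" and x: "nonzerodivisor R x"
    and res: "module R N" "free_resolution R N rk d \<epsilon>"
    and ann: "m \<subseteq> carrier R" "\<And>a u. a \<in> m \<Longrightarrow> u \<in> carrier N \<Longrightarrow> a \<odot>\<^bsub>N\<^esub> u = \<zero>\<^bsub>N\<^esub>"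
    and g: "g \<in> module_hom R (free_module R (rk 1)) ((regular_module R)\<lparr>carrier := I\<rparr>)"
    and cocycle: "\<And>w. w \<in> carrier (free_module R (rk 2)) \<Longrightarrow> g (d 1 w) = \<zero>\<^bsub>R\<^esub>"
    and x_mem: "\<iota> x \<in> ideal_prod Q (\<iota> ` m) (frac_colon R Q \<iota> x I)"
  shows "\<exists>h\<in>module_hom R (free_module R (rk 0)) (regular_module R).
    \<forall>v\<in>carrier (free_module R (rk 1)). h (d 0 v) = g v"
proof -
  interpret total_ring_of_fractions R Q \<iota> by (rule Q)
  interpret free_complex R rk d by (rule free_resolution_complex[OF R.is_cring res(2)])
  have xc: "x \<in> carrier R" using x by (simp add: nonzerodivisor_def)
  have "\<iota> x \<in> carrier Q \<and> (\<exists>h\<in>module_hom R (F 0) (regular_module R).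
      \<forall>v\<in>carrier (F 1). \<iota> x \<otimes>\<^bsub>Q\<^esub> \<iota> (h (d 0 v)) = \<iota> x \<otimes>\<^bsub>Q\<^esub> \<iota> (g v))"
    by (rule ideal_prod_cocycle_bounds[OF Q I x res ann(1) _ g _ x_mem])
      (rule ann(2) cocycle, assumption+)+
  then obtain h where h: "h \<in> module_hom R (F 0) (regular_module R)"
    "\<forall>v\<in>carrier (F 1). \<iota> x \<otimes>\<^bsub>Q\<^esub> \<iota> (h (d 0 v)) = \<iota> x \<otimes>\<^bsub>Q\<^esub> \<iota> (g v)"
    by (elim conjE bexE)
  have "h (d 0 v) = g v" if v: "v \<in> carrier (F 1)" for v
  proof -
    have hc: "h (d 0 v) \<in> carrier R"
      using module_hom_apply[OF h(1) d_closed[of v 0]] v by simp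
    have "g v \<in> I" using module_hom_apply[OF g v] by simp
    then have gc: "g v \<in> carrier R" by (rule ideal.Icarr[OF I])
    have "\<iota> (x \<otimes>\<^bsub>R\<^esub> h (d 0 v)) = \<iota> (x \<otimes>\<^bsub>R\<^esub> g v)"
      using bspec[OF h(2) v] by (simp only: ring_hom_mult[OF hom xc hc] ring_hom_mult[OF hom xc gc])
    then have "x \<otimes>\<^bsub>R\<^esub> h (d 0 v) = x \<otimes>\<^bsub>R\<^esub> g v"
      by (rule inj_onD[OF inj _ R.m_closed[OF xc hc] R.m_closed[OF xc gc]])
    then show ?thesis by (rule nonzerodivisor_cancel[OF R.is_cring x hc gc])
  qed
  with h(1) show ?thesis by (intro bexI[of _ h] ballI)
qed

section \<open>Elias ideals\<close>

text \<open>The assumption \<open>bounds\<close> is the vanishing of \<open>Ext\<^sup>1(k, I) \<rightarrow> Ext\<^sup>1(k, R)\<close>; it makes the map from \<open>P\<close> to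
  \<open>Ext\<^sup>1(k, I)\<close> surjective. The map from \<open>P\<close> to \<open>Ext\<^sup>0(k, R/I)\<close> is surjective because homomorphisms from the
  free module \<open>F\<^sub>0\<close> to \<open>R/I\<close> lift to \<open>R\<close>.\<close>
lemma residue_cohomology_dim_eq:
  fixes R :: "('a, 'r) ring_scheme" and rk d \<epsilon>
  assumes "cring R" and m: "maximalideal m R" and I: "ideal I R"
    and x: "x \<in> m" "nonzerodivisor R x"
    and res: "free_resolution R (quotient_module (regular_module R) m) rk d \<epsilon>"
    and ann: "\<And>a u. a \<in> m \<Longrightarrow> u \<in> carrier (quotient_module (regular_module R) m) \<Longrightarrow>
      a \<odot>\<^bsub>quotient_module (regular_module R) m\<^esub> u = \<zero>\<^bsub>quotient_module (regular_module R) m\<^esub>"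
    and bounds: "\<And>g. g \<in> module_hom R (free_module R (rk (Suc 0))) ((regular_module R)\<lparr>carrier := I\<rparr>) \<Longrightarrow>
      (\<And>w. w \<in> carrier (free_module R (rk (Suc (Suc 0)))) \<Longrightarrow> g (d (Suc 0) w) = \<zero>\<^bsub>R\<^esub>) \<Longrightarrow>
      \<exists>h\<in>module_hom R (free_module R (rk 0)) (regular_module R).
        \<forall>v\<in>carrier (free_module R (rk (Suc 0))). h (d 0 v) = g v"
  shows "vectorspace.dim (R Quot m) (residue_module
      (hom_cohomology R rk d ((regular_module R)\<lparr>carrier := I\<rparr>) (Suc 0))) =
    vectorspace.dim (R Quot m) (residue_module
      (hom_cohomology R rk d (quotient_module (regular_module R) I) 0))"
proof -
  interpret free_complex R rk d by (rule free_resolution_complex[OF assms(1) res])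
  let ?reg = "regular_module R"
  let ?I = "?reg\<lparr>carrier := I\<rparr>" and ?RI = "quotient_module ?reg I" and ?k = "quotient_module ?reg m"
  let ?H = "hom_module R (F 0) ?reg"
  note reg = regular_module_is_module[OF assms(1)]
  note I_sub = ideal_is_submodule[OF assms(1) I]
  note I_mod = module.submodule_is_module[OF reg I_sub]
  note RI_mod = quotient_module_is_module[OF I_sub]
  note H_mod = hom_module_is_module[OF F_module reg, of 0]
  have Icarr: "a \<in> carrier R" if "a \<in> I" for a by (rule ideal.Icarr[OF I that])
  have mcarr: "a \<in> carrier R" if "a \<in> m" for a
    by (rule ideal.Icarr[OF maximalideal.axioms(1)[OF m] that])
  have \<epsilon>: "\<epsilon> \<in> module_hom R (F 0) ?k"
    and ex0: "d 0 ` carrier (F (Suc 0)) = {v \<in> carrier (F 0). \<epsilon> v = \<zero>\<^bsub>?k\<^esub>}"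
    using res unfolding free_resolution_def Let_def One_nat_def by blast+
  have d0: "d 0 \<in> module_hom R (F (Suc 0)) (F 0)" by (rule d_hom)
  have d0_closed: "d 0 v \<in> carrier (F 0)" if "v \<in> carrier (F (Suc 0))" for v
    by (rule d_closed[OF that])

  \<comment> \<open>\<open>m\<close> annihilates \<open>k\<close>, so \<open>m F\<^sub>0\<close> lies in the kernel of \<open>\<epsilon>\<close>, which is the image of \<open>d 0\<close>.\<close>
  have multiple: "\<exists>w \<in> carrier (F (Suc 0)). d 0 w = a \<odot>\<^bsub>F 0\<^esub> v" if a: "a \<in> m" and v: "v \<in> carrier (F 0)" for a v
  proof -
    have "\<epsilon> (a \<odot>\<^bsub>F 0\<^esub> v) = \<zero>\<^bsub>?k\<^esub>"
      using module_hom_smult[OF \<epsilon> mcarr[OF a] v] ann[OF a module_hom_apply[OF \<epsilon> v]] by (simp only:)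
    moreover have "a \<odot>\<^bsub>F 0\<^esub> v \<in> carrier (F 0)"
      by (rule module.smult_closed[OF F_module mcarr[OF a] v])
    ultimately have "a \<odot>\<^bsub>F 0\<^esub> v \<in> d 0 ` carrier (F (Suc 0))" unfolding ex0 by (intro CollectI conjI)
    then obtain w where "a \<odot>\<^bsub>F 0\<^esub> v = d 0 w" "w \<in> carrier (F (Suc 0))" by (rule imageE)
    then show ?thesis by (intro bexI[of _ w]) (simp only:)
  qed

  \<comment> \<open>The image of \<open>d 0\<close> contains \<open>x F\<^sub>0\<close>, and \<open>x\<close> is a nonzerodivisor.\<close>
  have determined: "h v = h' v"
    if h: "h \<in> module_hom R (F 0) ?reg" and h': "h' \<in> module_hom R (F 0) ?reg"
      and eq: "\<And>w. w \<in> carrier (F (Suc 0)) \<Longrightarrow> h (d 0 w) = h' (d 0 w)" and v: "v \<in> carrier (F 0)"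
    for h h' v
  proof -
    obtain w where w: "w \<in> carrier (F (Suc 0))" "d 0 w = x \<odot>\<^bsub>F 0\<^esub> v"
      using multiple[OF x(1) v] by (elim bexE)
    have "x \<otimes>\<^bsub>R\<^esub> h v = h (d 0 w)" "x \<otimes>\<^bsub>R\<^esub> h' v = h' (d 0 w)"
      unfolding w(2) using module_hom_smult[OF h mcarr[OF x(1)] v] module_hom_smult[OF h' mcarr[OF x(1)] v]
      by (simp_all only: regular_module_simps)
    then have x_eq: "x \<otimes>\<^bsub>R\<^esub> h v = x \<otimes>\<^bsub>R\<^esub> h' v" using eq[OF w(1)] by (simp only:)
    have "h v \<in> carrier R" "h' v \<in> carrier R"
      using module_hom_apply[OF h v] module_hom_apply[OF h' v] by (simp_all only: regular_module_simps)
    from nonzerodivisor_cancel[OF assms(1) x(2) this x_eq] show ?thesis .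
  qed

  define P where "P = {h \<in> carrier ?H. \<forall>v\<in>carrier (F (Suc 0)). h (d 0 v) \<in> I}"
  have P_hom: "h \<in> module_hom R (F 0) ?reg" if "h \<in> P" for h
    using that by (simp add: P_def)
  have P_I: "h (d 0 v) \<in> I" if "h \<in> P" "v \<in> carrier (F (Suc 0))" for h v
    using that unfolding P_def by blast
  have P_ext: "h \<in> extensional (carrier (F 0))" if "h \<in> P" for h
    using that by (simp add: P_def del: func_space_simps)
  have PI: "restrict h (carrier (F 0)) \<in> P"
    if "h \<in> module_hom R (F 0) ?reg" "\<And>v. v \<in> carrier (F (Suc 0)) \<Longrightarrow> h (d 0 v) \<in> I" for h
    using that unfolding P_def
    by (simp add: module_hom_restrict[OF F_module] d0_closed del: func_space_simps)
  have P_sub: "LinearCombinations.submodule R P ?H"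
  proof (rule LinearCombinations.submodule.intro)
    show "module R ?H" by (rule H_mod)
    show "P \<subseteq> carrier ?H" unfolding P_def by (rule Collect_restrict)
    show "h \<oplus>\<^bsub>?H\<^esub> h' \<in> P" if "h \<in> P" "h' \<in> P" for h h'
      unfolding hom_module_simps
    proof (rule PI)
      show "(\<lambda>v. h v \<oplus>\<^bsub>?reg\<^esub> h' v) \<in> module_hom R (F 0) ?reg"
        by (rule module_hom_plus[OF F_module reg P_hom P_hom]) fact+
      show "h (d 0 v) \<oplus>\<^bsub>?reg\<^esub> h' (d 0 v) \<in> I" if "v \<in> carrier (F (Suc 0))" for v
        by (rule LinearCombinations.submodule.m_closed[OF I_sub P_I P_I]) fact+
    qed
    show "\<zero>\<^bsub>?H\<^esub> \<in> P"
      unfolding hom_module_simps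
      by (rule PI[OF module_hom_zero[OF F_module reg]])
        (rule LinearCombinations.submodule.zero_closed[OF I_sub])
    show "r \<odot>\<^bsub>?H\<^esub> h \<in> P" if "r \<in> carrier R" "h \<in> P" for r h
      unfolding hom_module_simps
    proof (rule PI)
      show "(\<lambda>v. r \<odot>\<^bsub>?reg\<^esub> h v) \<in> module_hom R (F 0) ?reg"
        by (rule module_hom_scale[OF F_module reg that(1) P_hom[OF that(2)]])
      show "r \<odot>\<^bsub>?reg\<^esub> h (d 0 v) \<in> I" if "v \<in> carrier (F (Suc 0))" for v
        by (rule LinearCombinations.submodule.smult_closed[OF I_sub _ P_I]) fact+
    qed
  qed
  let ?P = "?H\<lparr>carrier := P\<rparr>"
  have P_mod: "module R ?P" by (rule module.submodule_is_module[OF H_mod P_sub])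

  \<comment> \<open>The cocycles representing the images of \<open>h\<close> in \<open>Ext\<^sup>0(k, R/I)\<close> and \<open>Ext\<^sup>1(k, I)\<close>.\<close>
  define \<phi> where "\<phi> h = (\<lambda>v\<in>carrier (F 0). I +>\<^bsub>?reg\<^esub> h v)" for h :: "(nat \<Rightarrow> 'a) \<Rightarrow> 'a"
  define \<psi> where "\<psi> h = (\<lambda>v\<in>carrier (F (Suc 0)). h (d 0 v))" for h :: "(nat \<Rightarrow> 'a) \<Rightarrow> 'a"
  have \<phi>_hom: "\<phi> h \<in> module_hom R (F 0) ?RI" if "h \<in> P" for h
    unfolding \<phi>_def module_hom_restrict[OF F_module]
    by (rule mod_hom_compose[OF P_hom[OF that] quotient_map_hom[OF I_sub]])
  have \<psi>_hom: "\<psi> h \<in> module_hom R (F (Suc 0)) ?I" if "h \<in> P" for h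
    unfolding \<psi>_def module_hom_restrict[OF F_module]
      module_hom_codomain_iff[OF LinearCombinations.submodule.subset[OF I_sub]]
    using mod_hom_compose[OF d0 P_hom[OF that]] P_I[OF that]
    by (intro conjI ballI) (simp_all only: restrict_apply if_True)
  have hc: "h v \<in> carrier ?reg" if "h \<in> P" "v \<in> carrier (F 0)" for h v
    by (rule module_hom_apply[OF P_hom[OF that(1)] that(2)])

  have \<phi>_module_hom: "\<phi> \<in> module_hom R ?P (hom_module R (F 0) ?RI)"
    unfolding module_hom_def[of R ?P]
  proof (intro CollectI conjI allI impI)
    show "\<phi> \<in> carrier ?P \<rightarrow> carrier (hom_module R (F 0) ?RI)"
      using \<phi>_hom by (simp add: \<phi>_def del: func_space_simps quotient_module_simps)
    show "\<phi> (h \<oplus>\<^bsub>?P\<^esub> h') = \<phi> h \<oplus>\<^bsub>hom_module R (F 0) ?RI\<^esub> \<phi> h'"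
      if "h \<in> carrier ?P \<and> h' \<in> carrier ?P" for h h'
      unfolding \<phi>_def hom_module_simps
      by (rule restrict_ext)
        (use that hc in \<open>simp add: coset_add[OF I_sub] del: func_space_simps\<close>)
    show "\<phi> (r \<odot>\<^bsub>?P\<^esub> h) = r \<odot>\<^bsub>hom_module R (F 0) ?RI\<^esub> \<phi> h"
      if "r \<in> carrier R \<and> h \<in> carrier ?P" for r h
      unfolding \<phi>_def hom_module_simps
      by (rule restrict_ext)
        (use that hc in \<open>simp add: coset_smult[OF I_sub] del: func_space_simps\<close>)
  qed
  have \<phi>_cocycle: "\<phi> ` carrier ?P \<subseteq> cocycles R rk d ?RI 0"
  proof (rule image_subsetI)
    fix h assume h: "h \<in> carrier ?P"
    have hP: "h \<in> P" using h by simp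
    have "\<phi> h (d 0 v) = \<zero>\<^bsub>?RI\<^esub>" if v: "v \<in> carrier (F (Suc 0))" for v
      using coset_eq_zero_iff[OF I_sub hc[OF hP d0_closed[OF v]]] P_I[OF hP v] d0_closed[OF v]
      by (simp add: \<phi>_def del: func_space_simps)
    then show "\<phi> h \<in> cocycles R rk d ?RI 0"
      unfolding mem_cocycles_iff using \<phi>_hom[OF hP] by (simp add: \<phi>_def)
  qed

  have \<psi>_module_hom: "\<psi> \<in> module_hom R ?P (hom_module R (F (Suc 0)) ?I)"
    unfolding module_hom_def[of R ?P]
  proof (intro CollectI conjI allI impI)
    show "\<psi> \<in> carrier ?P \<rightarrow> carrier (hom_module R (F (Suc 0)) ?I)"
      using \<psi>_hom by (simp add: \<psi>_def del: func_space_simps)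
    show "\<psi> (h \<oplus>\<^bsub>?P\<^esub> h') = \<psi> h \<oplus>\<^bsub>hom_module R (F (Suc 0)) ?I\<^esub> \<psi> h'" for h h'
      unfolding \<psi>_def hom_module_simps
      by (rule restrict_ext) (simp add: d0_closed del: func_space_simps)
    show "\<psi> (r \<odot>\<^bsub>?P\<^esub> h) = r \<odot>\<^bsub>hom_module R (F (Suc 0)) ?I\<^esub> \<psi> h" for r h
      unfolding \<psi>_def hom_module_simps
      by (rule restrict_ext) (simp add: d0_closed del: func_space_simps)
  qed
  have \<psi>_cocycle: "\<psi> ` carrier ?P \<subseteq> cocycles R rk d ?I (Suc 0)"
  proof (rule image_subsetI)
    fix h assume h: "h \<in> carrier ?P"
    have hP: "h \<in> P" using h by simp
    have "\<psi> h (d (Suc 0) w) = \<zero>\<^bsub>?I\<^esub>" if w: "w \<in> carrier (F (Suc (Suc 0)))" for w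
      using d_d[OF w] d_closed[OF w] module_hom_apply_zero[OF F_module reg P_hom[OF hP]]
      by (simp add: \<psi>_def del: func_space_simps)
    then show "\<psi> h \<in> cocycles R rk d ?I (Suc 0)"
      unfolding mem_cocycles_iff using \<psi>_hom[OF hP] by (simp add: \<psi>_def)
  qed

  have \<phi>_zero: "\<phi> h \<in> coboundaries R rk d ?RI 0 \<longleftrightarrow> (\<forall>v\<in>carrier (F 0). h v \<in> I)" if "h \<in> P" for h
  proof -
    have "\<phi> h \<in> coboundaries R rk d ?RI 0 \<longleftrightarrow> (\<forall>v\<in>carrier (F 0). I +>\<^bsub>?reg\<^esub> h v = I)"
      unfolding coboundaries.simps \<phi>_def hom_module_simps quotient_module_simps singleton_iff
      by (simp only: fun_eq_iff restrict_def) auto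
    then show ?thesis
      using coset_eq_zero_iff[OF I_sub hc[OF that]] by (simp del: func_space_simps)
  qed
  have \<psi>_zero: "\<psi> h \<in> coboundaries R rk d ?I (Suc 0) \<longleftrightarrow> (\<forall>v\<in>carrier (F 0). h v \<in> I)" if "h \<in> P" for h
    unfolding mem_coboundaries_Suc_iff
  proof
    assume "\<exists>g\<in>module_hom R (F 0) ?I. \<psi> h = (\<lambda>v\<in>carrier (F (Suc 0)). g (d 0 v))"
    then obtain g where g: "g \<in> module_hom R (F 0) ?I" "\<psi> h = (\<lambda>v\<in>carrier (F (Suc 0)). g (d 0 v))"
      by (elim bexE)
    have g': "g \<in> module_hom R (F 0) ?reg" "\<forall>v\<in>carrier (F 0). g v \<in> I"
      using g(1) unfolding module_hom_codomain_iff[OF LinearCombinations.submodule.subset[OF I_sub]]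
      by - (elim conjE, assumption)+
    have "h (d 0 w) = g (d 0 w)" if "w \<in> carrier (F (Suc 0))" for w
      using fun_cong[OF g(2), of w] that by (simp add: \<psi>_def del: func_space_simps)
    then have "h v = g v" if "v \<in> carrier (F 0)" for v
      using that by (rule determined[OF P_hom[OF \<open>h \<in> P\<close>] g'(1)])
    with g'(2) show "\<forall>v\<in>carrier (F 0). h v \<in> I" by (simp del: func_space_simps)
  next
    assume "\<forall>v\<in>carrier (F 0). h v \<in> I"
    then have "h \<in> module_hom R (F 0) ?I"
      unfolding module_hom_codomain_iff[OF LinearCombinations.submodule.subset[OF I_sub]]
      using P_hom[OF that] by (intro conjI)
    then show "\<exists>g\<in>module_hom R (F 0) ?I. \<psi> h = (\<lambda>v\<in>carrier (F (Suc 0)). g (d 0 v))"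
      unfolding \<psi>_def by (intro bexI[of _ h] refl)
  qed

  have \<phi>_surj: "cocycles R rk d ?RI 0 \<subseteq> \<phi> ` carrier ?P"
  proof
    fix z assume "z \<in> cocycles R rk d ?RI 0"
    then have z: "z \<in> module_hom R (F 0) ?RI" "z \<in> extensional (carrier (F 0))"
      "\<forall>v\<in>carrier (F (Suc 0)). z (d 0 v) = \<zero>\<^bsub>?RI\<^esub>"
      unfolding mem_cocycles_iff by - (elim conjE, assumption)+
    have "z ` carrier (F 0) \<subseteq> (\<lambda>r. I +>\<^bsub>?reg\<^esub> r) ` carrier ?reg"
      using module_hom_apply[OF z(1)] unfolding quotient_module_simps by (rule image_subsetI)
    from module.free_module_lift[OF RI_mod reg z(1) quotient_map_hom[OF I_sub] this]
    obtain h where h: "h \<in> module_hom R (F 0) ?reg"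
      "\<And>v. v \<in> carrier (F 0) \<Longrightarrow> I +>\<^bsub>?reg\<^esub> h v = z v"
      by metis
    have "h (d 0 v) \<in> I" if v: "v \<in> carrier (F (Suc 0))" for v
    proof -
      have "I +>\<^bsub>?reg\<^esub> h (d 0 v) = I"
        using h(2)[OF d0_closed[OF v]] bspec[OF z(3) v] by (simp only: quotient_module_simps)
      then show ?thesis
        by (rule iffD1[OF coset_eq_zero_iff[OF I_sub module_hom_apply[OF h(1) d0_closed[OF v]]]])
    qed
    from PI[OF h(1) this] have "restrict h (carrier (F 0)) \<in> carrier ?P" by simp
    moreover have "z = \<phi> (restrict h (carrier (F 0)))"
    proof (rule extensionalityI[OF z(2)])
      show "\<phi> (restrict h (carrier (F 0))) \<in> extensional (carrier (F 0))"
        unfolding \<phi>_def by (rule restrict_extensional)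
      show "z v = \<phi> (restrict h (carrier (F 0))) v" if "v \<in> carrier (F 0)" for v
        using h(2)[OF that] that by (simp add: \<phi>_def del: func_space_simps)
    qed
    ultimately show "z \<in> \<phi> ` carrier ?P" by (rule rev_image_eqI[where f = \<phi>])
  qed
  have \<psi>_surj: "cocycles R rk d ?I (Suc 0) \<subseteq> \<psi> ` carrier ?P"
  proof
    fix z assume "z \<in> cocycles R rk d ?I (Suc 0)"
    then have z: "z \<in> module_hom R (F (Suc 0)) ?I" "z \<in> extensional (carrier (F (Suc 0)))"
      "\<forall>v\<in>carrier (F (Suc (Suc 0))). z (d (Suc 0) v) = \<zero>\<^bsub>?I\<^esub>"
      unfolding mem_cocycles_iff by - (elim conjE, assumption)+
    have "z (d (Suc 0) w) = \<zero>\<^bsub>R\<^esub>" if "w \<in> carrier (F (Suc (Suc 0)))" for w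
      using bspec[OF z(3) that] by simp
    then have "\<exists>h\<in>module_hom R (F 0) ?reg. \<forall>v\<in>carrier (F (Suc 0)). h (d 0 v) = z v"
      by (rule bounds[OF z(1)])
    then obtain h where h: "h \<in> module_hom R (F 0) ?reg" "\<forall>v\<in>carrier (F (Suc 0)). h (d 0 v) = z v"
      by (elim bexE)
    have "h (d 0 v) \<in> I" if v: "v \<in> carrier (F (Suc 0))" for v
      using module_hom_apply[OF z(1) v] bspec[OF h(2) v] by simp
    from PI[OF h(1) this] have "restrict h (carrier (F 0)) \<in> carrier ?P" by simp
    moreover have "z = \<psi> (restrict h (carrier (F 0)))"
    proof (rule extensionalityI[OF z(2)])
      show "\<psi> (restrict h (carrier (F 0))) \<in> extensional (carrier (F (Suc 0)))"
        unfolding \<psi>_def by (rule restrict_extensional)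
      show "z v = \<psi> (restrict h (carrier (F 0))) v" if "v \<in> carrier (F (Suc 0))" for v
        using bspec[OF h(2) that] that d0_closed[OF that] by (simp add: \<psi>_def del: func_space_simps)
    qed
    ultimately show "z \<in> \<psi> ` carrier ?P" by (rule rev_image_eqI[where f = \<psi>])
  qed

  note \<phi>_class = cohomology_class_map[OF RI_mod \<phi>_module_hom \<phi>_cocycle]
  note \<psi>_class = cohomology_class_map[OF I_mod \<psi>_module_hom \<psi>_cocycle]
  show ?thesis
  proof (rule residue_dim_eq[OF assms(1) m P_mod hom_cohomology_module[OF I_mod]
        hom_cohomology_module[OF RI_mod] \<psi>_class(1) \<psi>_class(3)[OF \<psi>_surj]
        \<phi>_class(1) \<phi>_class(3)[OF \<phi>_surj]])
    fix h assume h: "h \<in> carrier ?P"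
    have hP: "h \<in> P" using h by simp
    show "coboundaries R rk d ?I (Suc 0) +>\<^bsub>cocycle_module ?I (Suc 0)\<^esub> \<psi> h =
        \<zero>\<^bsub>hom_cohomology R rk d ?I (Suc 0)\<^esub> \<longleftrightarrow>
      coboundaries R rk d ?RI 0 +>\<^bsub>cocycle_module ?RI 0\<^esub> \<phi> h = \<zero>\<^bsub>hom_cohomology R rk d ?RI 0\<^esub>"
      unfolding \<phi>_class(2)[OF h] \<psi>_class(2)[OF h] \<phi>_zero[OF hP] \<psi>_zero[OF hP] ..
  next
    fix a h assume a: "a \<in> m" and h: "h \<in> carrier ?P"
    have hP: "h \<in> P" using h by simp
    have ah: "a \<odot>\<^bsub>?P\<^esub> h \<in> carrier ?P" by (rule module.smult_closed[OF P_mod mcarr[OF a] h])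
    then have ahP: "a \<odot>\<^bsub>?P\<^esub> h \<in> P" by simp
    have "(a \<odot>\<^bsub>?P\<^esub> h) v \<in> I" if v: "v \<in> carrier (F 0)" for v
    proof -
      obtain w where w: "w \<in> carrier (F (Suc 0))" "d 0 w = a \<odot>\<^bsub>F 0\<^esub> v"
        using multiple[OF a v] by (elim bexE)
      have "(a \<odot>\<^bsub>?P\<^esub> h) v = a \<odot>\<^bsub>?reg\<^esub> h v" using v by (simp del: func_space_simps)
      also have "\<dots> = h (d 0 w)"
        unfolding w(2) using module_hom_smult[OF P_hom[OF hP] mcarr[OF a] v] by (rule sym)
      finally show ?thesis using P_I[OF hP w(1)] by (simp only:)
    qed
    then show "coboundaries R rk d ?I (Suc 0) +>\<^bsub>cocycle_module ?I (Suc 0)\<^esub> \<psi> (a \<odot>\<^bsub>?P\<^esub> h) =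
        \<zero>\<^bsub>hom_cohomology R rk d ?I (Suc 0)\<^esub>"
      unfolding \<psi>_class(2)[OF ah] \<psi>_zero[OF ahP] by (rule ballI)
  qed
qed

lemma residue_field_annihilated:
  assumes "cring R" "ideal m R" "a \<in> m" "u \<in> carrier (quotient_module (regular_module R) m)"
  shows "a \<odot>\<^bsub>quotient_module (regular_module R) m\<^esub> u = \<zero>\<^bsub>quotient_module (regular_module R) m\<^esub>"
proof -
  note sub = ideal_is_submodule[OF assms(1,2)]
  have a: "a \<in> carrier R" by (rule ideal.Icarr[OF assms(2,3)])
  obtain r where r: "r \<in> carrier R" "u = m +>\<^bsub>regular_module R\<^esub> r"
    using assms(4) by auto
  have "a \<otimes>\<^bsub>R\<^esub> r \<in> m" by (rule ideal.I_r_closed[OF assms(2,3) r(1)])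
  moreover have "a \<otimes>\<^bsub>R\<^esub> r \<in> carrier (regular_module R)"
    using ideal.Icarr[OF assms(2) calculation] by simp
  ultimately show ?thesis
    using coset_smult[OF sub a, of r] coset_eq_zero_iff[OF sub, of "a \<otimes>\<^bsub>R\<^esub> r"] r by simp
qed

lemma cyclic_free_resolution_exists:
  assumes "cring R" "noetherian_ring R" "ideal J R"
  shows "\<exists>rk d \<epsilon>. free_resolution R (quotient_module (regular_module R) J) rk d \<epsilon>"
proof -
  interpret cring R by fact
  note sub = ideal_is_submodule[OF assms(1,3)]
  let ?\<epsilon> = "\<lambda>v. J +>\<^bsub>regular_module R\<^esub> v 0"
  have "(\<lambda>v. v (0::nat)) ` carrier (free_module R 1) = carrier R"
  proof
    show "carrier R \<subseteq> (\<lambda>v. v 0) ` carrier (free_module R 1)"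
      by (rule subsetI, rule image_eqI[where x = "\<lambda>i\<in>{..<1}. _"]) auto
  qed auto
  then have "(\<lambda>r. J +>\<^bsub>regular_module R\<^esub> r) ` (\<lambda>v. v 0) ` carrier (free_module R 1) =
      carrier (quotient_module (regular_module R) J)"
    by (simp only: quotient_module_simps regular_module_simps)
  then have surj: "?\<epsilon> ` carrier (free_module R 1) = carrier (quotient_module (regular_module R) J)"
    by (simp only: image_image)
  have "?\<epsilon> \<in> module_hom R (free_module R 1) (quotient_module (regular_module R) J)"
    by (rule mod_hom_compose[OF coordinate_hom[OF assms(1)] quotient_map_hom[OF sub]]) simp
  from free_resolution_exists[OF assms(1,2) quotient_module_is_module[OF sub] this surj]
  show ?thesis by metis
qed

theorem proposition3p11:
  fixes R :: "('a, 'r) ring_scheme" and Q :: "('q, 's) ring_scheme"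
    and m I :: "'a set" and \<iota> :: "'a \<Rightarrow> 'q" and x :: 'a
  assumes "cohen_macaulay_local_ring R m"
    and "krull_dim R = 1"
    and "total_ring_of_fractions R Q \<iota>"
    and "primary_to R m I"
    and "x \<in> m"
    and "nonzerodivisor R x"
    and "\<iota> x \<in> ideal_prod Q (\<iota> ` m) (frac_colon R Q \<iota> x I)"
  shows "Elias R m I"
proof -
  interpret cohen_macaulay_local_ring R m by fact
  have m: "maximalideal m R" by (rule maximal)
  have m_ideal: "ideal m R" by (rule maximalideal.axioms(1)[OF m])
  have I: "ideal I R" and rad: "radical R I = m"
    using assms(4) by (simp_all add: primary_to_def primary_ideal_def)
  have m_carr: "m \<subseteq> carrier R" using ideal.Icarr[OF m_ideal] by (rule subsetI)
  let ?reg = "regular_module R"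
  let ?k = "quotient_module ?reg m"
  have cr: "cring R" by (rule is_cring)
  have k_mod: "module R ?k"
    by (rule quotient_module_is_module[OF ideal_is_submodule[OF cr m_ideal]])
  \<comment> \<open>The resolution of \<open>k\<close> on which both types are computed.\<close>
  define c where "c = (SOME (rk, d). \<exists>\<epsilon>. free_resolution R ?k rk d \<epsilon>)"
  obtain rk d where c: "c = (rk, d)" by (rule prod.exhaust)
  have "\<exists>c. case c of (rk, d) \<Rightarrow> \<exists>\<epsilon>. free_resolution R ?k rk d \<epsilon>"
    using cyclic_free_resolution_exists[OF cr noetherian_ring_axioms m_ideal] by simp
  from someI_ex[OF this] obtain \<epsilon> where res: "free_resolution R ?k rk d \<epsilon>"
    unfolding c_def[symmetric] c prod.case by (elim exE)
  have Ext: "Ext_module R ?k M n = hom_cohomology R rk d M n" for M :: "('a, 'v) module" and n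
    unfolding Ext_module_def c_def[symmetric] c prod.case ..
  have "x \<in> radical R I" using assms(5) rad by simp
  then obtain n :: nat where n: "x [^]\<^bsub>R\<^esub> n \<in> I" unfolding radical_def by (elim CollectE conjE exE)
  \<comment> \<open>A power of \<open>x\<close> lies in \<open>I\<close>, so \<open>I\<close> is faithful and has the dimension of \<open>R\<close>.\<close>
  have "module_dim R (?reg\<lparr>carrier := I\<rparr>) = 1"
    using annihilator_ideal_with_nonzerodivisor[OF cr I n nonzerodivisor_power[OF cr assms(6)]]
      krull_dim_quotient_zero[OF cr] assms(2) by (simp add: module_dim_def)
  then have dim_I: "the_enat (module_dim R (?reg\<lparr>carrier := I\<rparr>)) = Suc 0"
    by (simp add: one_enat_def)
  have "module_dim R (quotient_module ?reg I) = 0"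
    using annihilator_quotient[OF cr I] krull_dim_quotient_primary_maximal[OF cr I m rad]
    by (simp add: module_dim_def)
  then have dim_RI: "the_enat (module_dim R (quotient_module ?reg I)) = 0"
    by (simp add: zero_enat_def)
  note ann = residue_field_annihilated[OF cr m_ideal]
  show ?thesis
    unfolding Elias_def module_type_def dim_I dim_RI Ext
  proof (rule residue_cohomology_dim_eq[OF cr m I assms(5,6) res ann])
    fix g
    assume g: "g \<in> module_hom R (free_module R (rk (Suc 0))) (?reg\<lparr>carrier := I\<rparr>)"
      and cocycle: "\<And>w. w \<in> carrier (free_module R (rk (Suc (Suc 0)))) \<Longrightarrow> g (d (Suc 0) w) = \<zero>\<^bsub>R\<^esub>"
    have g1: "g \<in> module_hom R (free_module R (rk 1)) (?reg\<lparr>carrier := I\<rparr>)"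
      using g by (simp only: One_nat_def)
    have cocycle1: "g (d 1 w) = \<zero>\<^bsub>R\<^esub>" if "w \<in> carrier (free_module R (rk 2))" for w
      using cocycle[of w] that by (simp only: One_nat_def numeral_2_eq_2)
    have "\<exists>h\<in>module_hom R (free_module R (rk 0)) ?reg.
        \<forall>v\<in>carrier (free_module R (rk 1)). h (d 0 v) = g v"
      by (rule cocycle_into_ideal_is_coboundary[OF assms(3) I assms(6) k_mod res m_carr _ g1 _ assms(7)])
        (rule ann cocycle1, assumption+)+
    then show "\<exists>h\<in>module_hom R (free_module R (rk 0)) ?reg.
        \<forall>v\<in>carrier (free_module R (rk (Suc 0))). h (d 0 v) = g v"
      by (simp only: One_nat_def)
  qed
qed

end
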